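(* Let $\Gamma\subset\mathbb{R}^d$ be an acute closed convex solid cone and let $\Phi$ be the Stieltjes–Fantappiè transform of a finite positive measure $\mu$ on $\Gamma^*$: $$\Phi(z,z_0)=\int_{\Gamma^*}\frac{d\mu(x)}{z_0+z\cdot x},\qquad (z,z_0)\in T_{\Gamma\times\mathbb{R}_+}.$$ Fix a point $(\lambda,1)\in\operatorname{int}\Gamma\times\mathbb{R}_+$. Then there exists a sequence $\{\Phi_n\}_n$ of rational Herglotz–Nevanlinna functions on the tube domain $T_{\Gamma\times\mathbb{R}_+}$ such that $\Phi_n$ converges to $\Phi$ uniformly on compact subsets of $T_{\Gamma\times\mathbb{R}_+}$, and the Taylor coefficients of $\Phi_n$ and $\Phi$ at the point $(\lambda,1)$ are the same up to order $n$. Moreover, each $\Phi_n$ is a directional Stieltjes sum.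
   Context: $\Gamma\subset\mathbb{R}^d$ is a closed convex cone with vertex $0$, acute (containing no line) and solid (with non-empty interior); $\Gamma^*=\{y\in\mathbb{R}^d: y\cdot x\ge 0\ \forall x\in\Gamma\}$. $\mathbb{R}_+=(0,\infty)$ and $T_{\Gamma\times\mathbb{R}_+}=(\operatorname{int}\Gamma\times\mathbb{R}_+)+i\,\mathbb{R}^{d+1}\subset\mathbb{C}^{d+1}$, with points written $(z,z_0)$, $z\in\mathbb{C}^d$, $z_0\in\mathbb{C}$. A Herglotz–Nevanlinna function on a domain is a holomorphic function with non-negative real part there. A (rational) function $\Psi(z,z_0)$ is called a directional Stieltjes sum if for each fixed $\omega\in\Gamma$ there are finitely many real numbers $c_j\ge0$, $\gamma_j\ge0$ ($1\le j\le N$), depending on $\omega$, such that $\Psi(t\omega,z_0)=\sum_{j=1}^N\frac{c_j}{z_0+t\gamma_j}$ for all $t\in[0,\infty)$ and $\operatorname{Re}z_0>0$. *)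

theory Defs
  imports "HOL-Analysis.Analysis"
begin

subsection \<open>Cones\<close>

definition contains_no_line :: "('a::real_vector) set \<Rightarrow> bool" where
  "contains_no_line S \<longleftrightarrow> (\<forall>a v. v \<noteq> 0 \<longrightarrow> \<not> range (\<lambda>t::real. a + t *\<^sub>R v) \<subseteq> S)"

definition acute_solid_cone :: "(real^'n) set \<Rightarrow> bool" where
  "acute_solid_cone \<Gamma> \<longleftrightarrow>
     closed \<Gamma> \<and> convex \<Gamma> \<and> cone \<Gamma> \<and> contains_no_line \<Gamma> \<and> interior \<Gamma> \<noteq> {}"

definition dual_cone :: "(real^'n) set \<Rightarrow> (real^'n) set" where
  "dual_cone \<Gamma> = {y. \<forall>x\<in>\<Gamma>. y \<bullet> x \<ge> 0}"

subsection \<open>The space of points \<open>(z, z\<^sub>0)\<close> and the tube domain\<close>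

type_synonym 'n cpoint = "(complex^'n) \<times> complex"

text \<open>The \<open>d + 1\<close> coordinates of \<open>(z, z\<^sub>0)\<close> are indexed by \<^typ>\<open>'n option\<close>:
  \<open>Some i\<close> stands for \<open>z\<^sub>i\<close> and \<open>None\<close> for \<open>z\<^sub>0\<close>.\<close>

fun coord :: "('n::finite) option \<Rightarrow> 'n cpoint \<Rightarrow> complex" where
  "coord None (z, z0) = z0"
| "coord (Some i) (z, z0) = z $ i"

fun coord_vec :: "'n option \<Rightarrow> ('n::finite) cpoint" where
  "coord_vec None = (0, 1)"
| "coord_vec (Some i) = (axis i 1, 0)"

definition cscale :: "complex \<Rightarrow> ('n::finite) cpoint \<Rightarrow> 'n cpoint" where
  "cscale c p = (c *s fst p, c * snd p)"

definition Re_vec :: "complex^'n \<Rightarrow> real^'n" where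
  "Re_vec z = (\<chi> i. Re (z $ i))"

definition complex_vec :: "real^'n \<Rightarrow> complex^'n" where
  "complex_vec x = (\<chi> i. complex_of_real (x $ i))"

definition tube :: "(real^'n) set \<Rightarrow> ('n::finite) cpoint set" where
  "tube \<Gamma> = {(z, z0). Re_vec z \<in> interior \<Gamma> \<and> Re z0 > 0}"

subsection \<open>Functions of several complex variables\<close>

text \<open>Complex Frechet differentiability: the real derivative exists and is complex linear.\<close>

definition sv_holomorphic_on :: "(('n::finite) cpoint \<Rightarrow> complex) \<Rightarrow> 'n cpoint set \<Rightarrow> bool" where
  "sv_holomorphic_on f U \<longleftrightarrow>
     (\<forall>p\<in>U. \<exists>D. (f has_derivative D) (at p) \<and> (\<forall>c h. D (cscale c h) = c * D h))"

definition herglotz_nevanlinna_on :: "(('n::finite) cpoint \<Rightarrow> complex) \<Rightarrow> 'n cpoint set \<Rightarrow> bool" where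
  "herglotz_nevanlinna_on f U \<longleftrightarrow> sv_holomorphic_on f U \<and> (\<forall>p\<in>U. Re (f p) \<ge> 0)"

definition partial_deriv ::
    "'n option \<Rightarrow> (('n::finite) cpoint \<Rightarrow> complex) \<Rightarrow> 'n cpoint \<Rightarrow> complex" where
  "partial_deriv i f p = deriv (\<lambda>w. f (p + cscale w (coord_vec i))) 0"

text \<open>The multi-index derivative applies the partial derivatives one coordinate after another,
  in an arbitrary but fixed order of the coordinates.  Near a point where the function is
  holomorphic the partial derivatives commute, so the order does not matter there.\<close>

definition coord_list :: "('n::finite) option list" where
  "coord_list = (SOME xs. distinct xs \<and> set xs = UNIV)"

definition multi_deriv ::
    "('n option \<Rightarrow> nat) \<Rightarrow> (('n::finite) cpoint \<Rightarrow> complex) \<Rightarrow> 'n cpoint \<Rightarrow> complex" where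
  "multi_deriv \<alpha> f = foldr (\<lambda>i. partial_deriv i ^^ \<alpha> i) coord_list f"

definition taylor_coeff ::
    "(('n::finite) cpoint \<Rightarrow> complex) \<Rightarrow> 'n cpoint \<Rightarrow> ('n option \<Rightarrow> nat) \<Rightarrow> complex" where
  "taylor_coeff f p \<alpha> = multi_deriv \<alpha> f p / (\<Prod>i\<in>UNIV. fact (\<alpha> i))"

definition cpolynomial :: "(('n::finite) cpoint \<Rightarrow> complex) \<Rightarrow> bool" where
  "cpolynomial P \<longleftrightarrow>
     (\<exists>(A :: ('n option \<Rightarrow> nat) set) (c :: ('n option \<Rightarrow> nat) \<Rightarrow> complex).
        finite A \<and> (\<forall>p. P p = (\<Sum>\<alpha>\<in>A. c \<alpha> * (\<Prod>i\<in>UNIV. coord i p ^ \<alpha> i))))"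

text \<open>\<open>f\<close> is on \<open>S\<close> a quotient of two polynomials that has no poles in \<open>S\<close>.\<close>

definition rational_on :: "(('n::finite) cpoint \<Rightarrow> complex) \<Rightarrow> 'n cpoint set \<Rightarrow> bool" where
  "rational_on f S \<longleftrightarrow>
     (\<exists>P Q. cpolynomial P \<and> cpolynomial Q \<and> (\<forall>p\<in>S. Q p \<noteq> 0 \<and> f p = P p / Q p))"

subsection \<open>Stieltjes-Fantappie transforms and directional Stieltjes sums\<close>

definition stieltjes_fantappie :: "(real^'n) measure \<Rightarrow> ('n::finite) cpoint \<Rightarrow> complex" where
  "stieltjes_fantappie \<mu> = (\<lambda>(z, z0).
     \<integral>x. 1 / (z0 + (\<Sum>i\<in>UNIV. z $ i * complex_of_real (x $ i))) \<partial>\<mu>)"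

text \<open>The points \<open>(t\<omega>, z\<^sub>0)\<close> at which directional Stieltjes sums are evaluated.  Since \<open>\<omega>\<close> may lie
  on the boundary of \<open>\<Gamma>\<close> and \<open>t\<close> may be \<open>0\<close>, they need not belong to the tube.  A rational
  function should therefore be given by the same quotient of polynomials on both sets.\<close>

definition directional_points :: "(real^'n) set \<Rightarrow> ('n::finite) cpoint set" where
  "directional_points \<Gamma> = {(complex_vec \<omega>, z0) | \<omega> z0. \<omega> \<in> \<Gamma> \<and> Re z0 > 0}"

definition directional_stieltjes_sum ::
    "(real^'n) set \<Rightarrow> (('n::finite) cpoint \<Rightarrow> complex) \<Rightarrow> bool" where
  "directional_stieltjes_sum \<Gamma> \<Psi> \<longleftrightarrow>
     (\<forall>\<omega>\<in>\<Gamma>. \<exists>(N::nat) (c :: nat \<Rightarrow> real) (\<gamma> :: nat \<Rightarrow> real).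
        (\<forall>j\<in>{1..N}. c j \<ge> 0 \<and> \<gamma> j \<ge> 0) \<and>
        (\<forall>t::real. \<forall>z0. t \<ge> 0 \<longrightarrow> Re z0 > 0 \<longrightarrow>
           \<Psi> (complex_vec (t *\<^sub>R \<omega>), z0) =
             (\<Sum>j=1..N. complex_of_real (c j) / (z0 + complex_of_real (t * \<gamma> j)))))"

end

(* Up to constants, the derivatives of the transform of M at (lambda, 1) of order at most n are the
   integrals against M of finitely many functions x^b / (1 + lambda.x)^m.  By the theorem of Richter
   and Tchakaloff there is a measure with finitely many atoms in the dual cone and the same integrals;
   its transform is Phi_n, a finite sum of terms c / (z0 + z.x) with c >= 0.

   For the convergence, put D = 1 + lambda.x and V = (1, x) / D, a point of a compact base of the dual
   of the cone [0, oo) x Gamma.  The kernel is 1 / (D <p, V>), and 1 / <p, v> is uniformly approximated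
   for p in a compact subset of the tube and v in the base by a polynomial (Stone-Weierstrass), of
   degree N in v, say.  The integrals of polynomials in V of degree at most N against dM / D are
   among the matched quantities once n >= N, and the total masses of dM / D agree. *)

theory Submission
  imports Defs
begin

subsection \<open>Convex cones and quadrature with finitely many atoms\<close>

text \<open>The dual cone is unbounded, and this shapes both halves of the argument. The integrand
  attached to a derivative of order k has a numerator of degree at most k over the power k + 1 of a
  pairing that grows at least like 1 + |x|. It is therefore bounded, so finiteness of the measure
  suffices. That extra power is also the fixed density 1 / D which remains when the integrand at
  (lambda, 1) is rewritten as a monomial in V. The base contains points whose first coordinate is 0,
  the directions at infinity of the dual cone; the kernel still has positive real part there, so the
  approximation does not deteriorate as x goes to infinity.

  The cone generated by the values of finitely many functions need not be closed, so a vector of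
  integrals outside it can only be separated weakly. Weak separation gives no contradiction but a
  linear relation among the functions that holds almost everywhere. Hence the induction on the
  number of functions, with atoms confined to the set where the relation holds.\<close>

definition nonneg_cone :: "('i \<Rightarrow> real) set \<Rightarrow> bool" where
  "nonneg_cone C \<longleftrightarrow> (\<lambda>i. 0) \<in> C \<and> (\<forall>y\<in>C. \<forall>z\<in>C. (\<lambda>i. y i + z i) \<in> C) \<and>
     (\<forall>y\<in>C. \<forall>s\<ge>0. (\<lambda>i. s * y i) \<in> C)"

lemma nonneg_cone_zero: "nonneg_cone C \<Longrightarrow> (\<lambda>i. 0) \<in> C"
  and nonneg_cone_add: "nonneg_cone C \<Longrightarrow> y \<in> C \<Longrightarrow> z \<in> C \<Longrightarrow> (\<lambda>i. y i + z i) \<in> C"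
  and nonneg_cone_scale: "nonneg_cone C \<Longrightarrow> y \<in> C \<Longrightarrow> s \<ge> 0 \<Longrightarrow> (\<lambda>i. s * y i) \<in> C"
  by (auto simp: nonneg_cone_def)

lemma nonneg_cone_shear:
  assumes "nonneg_cone C"
  shows "nonneg_cone ((\<lambda>y. y(j := y j - y i * t)) ` C)"
proof -
  have add: "(\<lambda>k. (y(j := y j - y i * t)) k + (z(j := z j - z i * t)) k)
      \<in> (\<lambda>y. y(j := y j - y i * t)) ` C" if "y \<in> C" "z \<in> C" for y z
    by (rule image_eqI[OF _ nonneg_cone_add[OF assms that]]) (auto simp: algebra_simps)
  have scale: "(\<lambda>k. s * (y(j := y j - y i * t)) k)
      \<in> (\<lambda>y. y(j := y j - y i * t)) ` C" if "y \<in> C" "s \<ge> 0" for y s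
    by (rule image_eqI[OF _ nonneg_cone_scale[OF assms that]]) (auto simp: algebra_simps)
  have zero: "(\<lambda>k. 0) \<in> (\<lambda>y. y(j := y j - y i * t)) ` C"
    by (rule image_eqI[OF _ nonneg_cone_zero[OF assms]]) auto
  show ?thesis
    unfolding nonneg_cone_def using zero add scale by (intro conjI ballI allI impI) (auto 4 0)
qed

text \<open>The index set is finite but of varying size, so the separation theorems for Euclidean spaces,
  whose dimension is fixed by the type, do not apply.\<close>

lemma proper_cone_in_half_space:
  fixes C :: "('i \<Rightarrow> real) set"
  assumes "finite I" and "nonneg_cone C" and "\<nexists>y. y \<in> C \<and> (\<forall>k\<in>I. y k = u k)"
  shows "\<exists>a. (\<exists>i\<in>I. a i \<noteq> 0) \<and> (\<forall>y\<in>C. (\<Sum>i\<in>I. a i * y i) \<ge> 0)"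
  using assms
proof (induction I arbitrary: C u rule: finite_psubset_induct)
  case (psubset I)
  note C = \<open>nonneg_cone C\<close>
  have "I \<noteq> {}" using psubset.prems nonneg_cone_zero[OF C] by auto
  then obtain j where j: "j \<in> I" by auto
  define J where "J = I - {j}"
  have IJ: "I = insert j J" "j \<notin> J" "finite J" "J \<subset> I"
    using j psubset.hyps by (auto simp: J_def)
  show ?case
  proof (cases "\<forall>u. \<exists>y\<in>C. \<forall>k\<in>J. y k = u k")
    case False
    then obtain u' where "\<nexists>y. y \<in> C \<and> (\<forall>k\<in>J. y k = u' k)" by blast
    \<comment> \<open>The projection of \<open>C\<close> to the coordinates in \<open>J\<close> is
      already proper; the functional found there is extended by 0 at \<open>j\<close>.\<close>
    from psubset.IH[OF IJ(4) C this] obtain a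
      where a: "\<exists>i\<in>J. a i \<noteq> 0" "\<forall>y\<in>C. (\<Sum>i\<in>J. a i * y i) \<ge> 0" by blast
    have "(\<Sum>i\<in>J. (a(j := 0)) i * y i) = (\<Sum>i\<in>J. a i * y i)" for y
      by (rule sum.cong) (use IJ in auto)
    then have "\<forall>y\<in>C. (\<Sum>i\<in>I. (a(j := 0)) i * y i) \<ge> 0"
      using a IJ by auto
    moreover have "\<exists>i\<in>I. (a(j := 0)) i \<noteq> 0" using a IJ by auto
    ultimately show ?thesis by (intro exI[of _ "a(j := 0)"] conjI)
  next
    case True
    \<comment> \<open>\<open>C\<close> projects onto all values of the coordinates in
      \<open>J\<close>. If it also contained both unit vectors of the \<open>j\<close> axis, every
      \<open>u\<close> could be reached by correcting coordinate \<open>j\<close>; so one of the two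
      directions \<open>\<sigma>\<close> is missing.\<close>
    obtain \<sigma> :: real where \<sigma>: "\<sigma> = 1 \<or> \<sigma> = -1"
      and no: "\<nexists>y. y \<in> C \<and> (\<forall>k\<in>J. y k = 0) \<and> y j = \<sigma>"
    proof (rule ccontr)
      assume neg: "\<not> thesis"
      from neg that[of 1] obtain p where p: "p \<in> C" "\<forall>k\<in>J. p k = 0" "p j = 1" by auto
      from neg that[of "-1"] obtain q where q: "q \<in> C" "\<forall>k\<in>J. q k = 0" "q j = -1" by auto
      from True obtain y where y: "y \<in> C" "\<forall>k\<in>J. y k = u k" by blast
      define s where "s = u j - y j"
      have "(\<lambda>k. y k + (max s 0 * p k + max (-s) 0 * q k)) \<in> C"
        by (intro nonneg_cone_add[OF C] nonneg_cone_scale[OF C] y p q) auto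
      moreover have "\<forall>k\<in>I. y k + (max s 0 * p k + max (-s) 0 * q k) = u k"
        using y p q IJ by (auto simp: s_def max_def)
      ultimately show False using psubset.prems(2) by (auto dest: spec)
    qed
    have no': "\<sigma> * y j \<le> 0" if "y \<in> C" "\<forall>k\<in>J. y k = 0" for y
    proof (rule ccontr)
      assume "\<not> ?thesis"
      then have pos: "\<sigma> * y j > 0" by simp
      have "(\<lambda>k. (1 / (\<sigma> * y j)) * y k) \<in> C"
        using pos that(1) by (intro nonneg_cone_scale[OF C]) auto
      moreover have "(1 / (\<sigma> * y j)) * y j = \<sigma>" using \<sigma> pos by auto
      ultimately show False using no that by auto
    qed
    show ?thesis
    proof (cases "J = {}")
      case True
      then have "\<forall>y\<in>C. (\<Sum>i\<in>I. - \<sigma> * y i) \<ge> 0" using no' IJ by auto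
      moreover have "\<exists>i\<in>I. - \<sigma> \<noteq> 0" using \<sigma> j by auto
      ultimately show ?thesis by (intro exI[of _ "\<lambda>_. - \<sigma>"] conjI)
    next
      case False
      then obtain i where i: "i \<in> J" by blast
      define e where "e k = (if k = i then 1 else 0 :: real)" for k
      \<comment> \<open>Call \<open>\<sigma> * y j\<close> the height of \<open>y\<close>.
        \<open>S\<close> collects the heights over the basis vector \<open>e\<close>; a point over
        \<open>- e\<close> bounds them, since sums of the two lie over 0, where heights are
        nonpositive. The supremum need not be attained, as \<open>C\<close> need not be
        closed.\<close>
      define S where "S = {\<sigma> * y j | y. y \<in> C \<and> (\<forall>k\<in>J. y k = e k)}"
      have "S \<noteq> {}" using True by (auto simp: S_def)
      have bdd: "bdd_above S"
      proof -
        from True obtain z where z: "z \<in> C" "\<forall>k\<in>J. z k = - e k" by meson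
        have "s \<le> - (\<sigma> * z j)" if "s \<in> S" for s
        proof -
          from that obtain y where y: "y \<in> C" "\<forall>k\<in>J. y k = e k" "s = \<sigma> * y j"
            by (auto simp: S_def)
          have "\<sigma> * (y j + z j) \<le> 0"
            using no'[OF nonneg_cone_add[OF C y(1) z(1)]] y z by auto
          then show ?thesis using y by (simp add: algebra_simps)
        qed
        then show ?thesis by (rule bdd_aboveI)
      qed
      define \<tau> where "\<tau> = Sup S"
      \<comment> \<open>Adding the line through \<open>e\<^sub>i + \<sigma> \<tau> e\<^sub>j\<close> does not make the cone everything; projecting along
        this line (the shear below) eliminates the coordinate \<open>i\<close>.\<close>
      let ?C = "(\<lambda>y. y(j := y j - y i * (\<sigma> * \<tau>))) ` C"
      have no_cover: "\<nexists>y. y \<in> ?C \<and> (\<forall>k\<in>I - {i}. y k = (if k = j then \<sigma> else 0))"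
      proof
        assume "\<exists>y. y \<in> ?C \<and> (\<forall>k\<in>I - {i}. y k = (if k = j then \<sigma> else 0))"
        then obtain y where y: "y \<in> C"
          and y': "\<forall>k\<in>I - {i}. (y(j := y j - y i * (\<sigma> * \<tau>))) k = (if k = j then \<sigma> else 0)"
          by blast
        define s where "s = y i"
        have yJ: "\<forall>k\<in>J. y k = s * e k"
          using y' IJ by (auto simp: s_def e_def split: if_splits)
        have "y j - s * (\<sigma> * \<tau>) = \<sigma>"
          using bspec[OF y', of j] j IJ i by (auto simp: s_def split: if_splits)
        then have "\<sigma> * (y j - s * (\<sigma> * \<tau>)) = 1" using \<sigma> by auto
        then have yj: "\<sigma> * y j = 1 + s * \<tau>" using \<sigma> by auto
        \<comment> \<open>Here \<open>y\<close> lies over \<open>s * e\<close> at height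
          \<open>1 + s * \<tau>\<close>. For \<open>s = 0\<close> this is a positive height over 0.
          For \<open>s > 0\<close> rescaling gives a point over \<open>e\<close> above the supremum.
          For \<open>s < 0\<close> adding \<open>- s\<close> times a point over \<open>e\<close>
          whose height exceeds \<open>\<tau> - 1 / (- s)\<close> gives a positive height over
          0.\<close>
        consider "s = 0" | "s > 0" | "s < 0" by linarith
        then show False
        proof cases
          case 1
          then show False using no'[OF y] yJ yj by auto
        next
          case 2
          have "(\<lambda>k. (1 / s) * y k) \<in> C"
            using 2 y by (intro nonneg_cone_scale[OF C]) auto
          then have "\<sigma> * ((1 / s) * y j) \<in> S"
            unfolding S_def using yJ 2 by (auto intro!: exI[of _ "\<lambda>k. (1 / s) * y k"])
          then have "\<sigma> * ((1 / s) * y j) \<le> \<tau>" unfolding \<tau>_def using bdd by (rule cSup_upper)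
          moreover have "\<sigma> * ((1 / s) * y j) = 1 / s + \<tau>" using yj 2 by (simp add: field_simps)
          ultimately show False using 2 by (simp add: field_simps)
        next
          case 3
          then have "\<tau> - 1 / (- s) < Sup S" by (simp add: \<tau>_def field_simps)
          then obtain z where z: "z \<in> C" "\<forall>k\<in>J. z k = e k" and zj: "\<tau> - 1 / (- s) < \<sigma> * z j"
            using less_cSupD[OF \<open>S \<noteq> {}\<close>] by (auto simp: S_def)
          have "\<sigma> * (y j + (- s) * z j) \<le> 0"
            using no'[OF nonneg_cone_add[OF C y nonneg_cone_scale[OF C z(1), of "- s"]]] 3 yJ z
            by auto
          moreover have "\<sigma> * (y j + (- s) * z j) = 1 + s * \<tau> + (- s) * (\<sigma> * z j)"
            using yj by (simp add: algebra_simps)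
          moreover have "(- s) * (\<tau> - 1 / (- s)) < (- s) * (\<sigma> * z j)"
            using 3 zj by (intro mult_strict_left_mono) auto
          moreover have "(- s) * (\<tau> - 1 / (- s)) = - (s * \<tau>) - 1" using 3 by (simp add: field_simps)
          ultimately show False by linarith
        qed
      qed
      have "I - {i} \<subset> I" using i IJ by auto
      from psubset.IH[OF this nonneg_cone_shear[OF C] no_cover]
      obtain a where a: "\<exists>k\<in>I - {i}. a k \<noteq> 0"
        "\<forall>y\<in>?C. (\<Sum>k\<in>I - {i}. a k * y k) \<ge> 0"
        by (elim exE conjE)
      \<comment> \<open>The coefficient at \<open>i\<close> makes \<open>b\<close> the composition
        of the functional \<open>a\<close> with the shear.\<close>
      define b where "b = a(i := - (a j * (\<sigma> * \<tau>)))"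
      have "(\<Sum>k\<in>I. b k * y k) \<ge> 0" if y: "y \<in> C" for y
      proof -
        have ij: "i \<noteq> j" "i \<in> I" using i IJ by auto
        have I': "I - {i} = insert j (J - {i})" using IJ ij by auto
        have "0 \<le> (\<Sum>k\<in>I - {i}. a k * (y(j := y j - y i * (\<sigma> * \<tau>))) k)"
          using a y by auto
        also have "\<dots> = a j * (y j - y i * (\<sigma> * \<tau>)) + (\<Sum>k\<in>J - {i}. a k * y k)"
        proof -
          have "(\<Sum>k\<in>J - {i}. a k * (y(j := y j - y i * (\<sigma> * \<tau>))) k) = (\<Sum>k\<in>J - {i}. a k * y k)"
            by (rule sum.cong) (use IJ(2) in auto)
          then show ?thesis unfolding I' using IJ(2,3) by (subst sum.insert) simp_all
        qed
        also have "\<dots> = b i * y i + (\<Sum>k\<in>I - {i}. a k * y k)"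
          unfolding I' using IJ(2,3) by (subst sum.insert) (simp_all add: b_def algebra_simps)
        also have "(\<Sum>k\<in>I - {i}. a k * y k) = (\<Sum>k\<in>I - {i}. b k * y k)"
          by (rule sum.cong) (auto simp: b_def)
        also have "b i * y i + \<dots> = (\<Sum>k\<in>I. b k * y k)"
          using psubset.hyps ij by (subst (2) sum.remove[of _ i]) auto
        finally show ?thesis .
      qed
      moreover have "\<exists>k\<in>I. b k \<noteq> 0" using a by (auto simp: b_def)
      ultimately show ?thesis by (intro exI[of _ b]) blast
    qed
  qed
qed

text \<open>The half-space result is applied to the cone generated by \<open>C\<close> and
  \<open>- m\<close>. It is still proper: if it reached \<open>m\<close>, then
  \<open>y - s * m = m\<close> on \<open>I\<close> would make \<open>y / (1 + s)\<close> a point of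
  \<open>C\<close> that agrees with \<open>m\<close>. The functional may vanish at \<open>m\<close>,
  so the separation is only weak.\<close>

lemma cone_separation:
  fixes C :: "('i \<Rightarrow> real) set"
  assumes "finite I" and C: "nonneg_cone C" and m: "\<nexists>y. y \<in> C \<and> (\<forall>k\<in>I. y k = m k)"
  obtains a where "\<exists>i\<in>I. a i \<noteq> 0" "\<forall>y\<in>C. (\<Sum>i\<in>I. a i * y i) \<ge> 0" "(\<Sum>i\<in>I. a i * m i) \<le> 0"
proof -
  define D where "D = {\<lambda>k. y k - s * m k | y s. y \<in> C \<and> s \<ge> 0}"
  have DI: "(\<lambda>k. y k - s * m k) \<in> D" if "y \<in> C" "s \<ge> 0" for y s
    using that by (auto simp: D_def)
  have "nonneg_cone D"
    unfolding nonneg_cone_def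
  proof (intro conjI ballI allI impI)
    show "(\<lambda>i. 0) \<in> D" using DI[OF nonneg_cone_zero[OF C], of 0] by simp
  next
    fix y z assume "y \<in> D" "z \<in> D"
    then obtain y' s z' t where *: "y' \<in> C" "s \<ge> 0" "z' \<in> C" "t \<ge> 0"
      "y = (\<lambda>k. y' k - s * m k)" "z = (\<lambda>k. z' k - t * m k)" by (auto simp: D_def)
    show "(\<lambda>i. y i + z i) \<in> D"
      using DI[OF nonneg_cone_add[OF C *(1,3)], of "s + t"] * by (simp add: algebra_simps)
  next
    fix y and r :: real assume "y \<in> D" "r \<ge> 0"
    then obtain y' s where *: "y' \<in> C" "s \<ge> 0" "y = (\<lambda>k. y' k - s * m k)" by (auto simp: D_def)
    show "(\<lambda>i. r * y i) \<in> D"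
      using DI[OF nonneg_cone_scale[OF C *(1) \<open>r \<ge> 0\<close>], of "r * s"] * \<open>r \<ge> 0\<close>
      by (simp add: algebra_simps)
  qed
  moreover have "\<nexists>y. y \<in> D \<and> (\<forall>k\<in>I. y k = m k)"
  proof
    assume "\<exists>y. y \<in> D \<and> (\<forall>k\<in>I. y k = m k)"
    then obtain y s where y: "y \<in> C" "s \<ge> 0" "\<forall>k\<in>I. y k - s * m k = m k" by (auto simp: D_def)
    have "(\<lambda>k. (1 / (1 + s)) * y k) \<in> C" using y by (intro nonneg_cone_scale[OF C]) auto
    moreover have "\<forall>k\<in>I. (1 / (1 + s)) * y k = m k"
      using y by (auto simp: field_simps)
    ultimately show False using m by (auto dest: spec)
  qed
  ultimately obtain a where a: "\<exists>i\<in>I. a i \<noteq> 0" "\<forall>y\<in>D. (\<Sum>i\<in>I. a i * y i) \<ge> 0"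
    using proper_cone_in_half_space[OF \<open>finite I\<close>] by blast
  have "\<forall>y\<in>C. (\<Sum>i\<in>I. a i * y i) \<ge> 0"
    using a(2) DI[of _ 0] by auto
  moreover have "(\<Sum>i\<in>I. a i * m i) \<le> 0"
    using a(2)[rule_format, OF DI[OF nonneg_cone_zero[OF C], of 1]] by (simp add: sum_negf)
  ultimately show thesis using that a by blast
qed

text \<open>If the vector of integrals is not in the cone generated by the values \<open>f x\<close>, a separating
  functional vanishes on almost all of these values, and then one of the functions is redundant.\<close>

lemma tchakaloff:
  fixes f :: "'i \<Rightarrow> 'x \<Rightarrow> real"
  assumes "finite I" and "\<And>i. i \<in> I \<Longrightarrow> integrable M (f i)"
    and "AE x in M. x \<in> Y" and "Y \<subseteq> space M"
  shows "\<exists>A c. finite A \<and> A \<subseteq> Y \<and> (\<forall>x\<in>A. c x \<ge> 0) \<and>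
    (\<forall>i\<in>I. (\<integral>x. f i x \<partial>M) = (\<Sum>x\<in>A. c x * f i x))"
  using assms
proof (induction I arbitrary: Y rule: finite_psubset_induct)
  case (psubset I)
  note int = psubset.prems(1)
  define C where "C = {\<lambda>i. \<Sum>x\<in>A. c x * f i x | A c. finite A \<and> A \<subseteq> Y \<and> (\<forall>x\<in>A. c x \<ge> 0)}"
  have C: "nonneg_cone C"
    unfolding nonneg_cone_def
  proof (intro conjI ballI allI impI)
    show "(\<lambda>i. 0) \<in> C" by (auto simp: C_def intro!: exI[of _ "{}"])
  next
    fix y z assume "y \<in> C" "z \<in> C"
    then obtain A c B d where A: "finite A" "A \<subseteq> Y" "\<forall>x\<in>A. c x \<ge> 0" "y = (\<lambda>i. \<Sum>x\<in>A. c x * f i x)"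
      and B: "finite B" "B \<subseteq> Y" "\<forall>x\<in>B. d x \<ge> 0" "z = (\<lambda>i. \<Sum>x\<in>B. d x * f i x)"
      unfolding C_def by blast
    define e where "e x = (if x \<in> A then c x else 0) + (if x \<in> B then d x else 0)" for x
    have "(\<Sum>x\<in>A \<union> B. e x * f i x) = y i + z i" for i
    proof -
      have "(\<Sum>x\<in>A \<union> B. e x * f i x) = (\<Sum>x\<in>A \<union> B. if x \<in> A then c x * f i x else 0)
          + (\<Sum>x\<in>A \<union> B. if x \<in> B then d x * f i x else 0)"
        unfolding sum.distrib[symmetric] by (rule sum.cong) (auto simp: e_def algebra_simps)
      also have "\<dots> = y i + z i"
        using A B by (simp add: sum.inter_restrict[symmetric] Int_absorb1)
      finally show ?thesis .
    qed
    then have "(\<lambda>i. y i + z i) = (\<lambda>i. \<Sum>x\<in>A \<union> B. e x * f i x)" by simp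
    moreover have "finite (A \<union> B)" "A \<union> B \<subseteq> Y" "\<forall>x\<in>A \<union> B. e x \<ge> 0"
      using A B by (auto simp: e_def)
    ultimately show "(\<lambda>i. y i + z i) \<in> C" unfolding C_def by blast
  next
    fix y and s :: real assume "y \<in> C" "s \<ge> 0"
    then obtain A c where A: "finite A" "A \<subseteq> Y" "\<forall>x\<in>A. c x \<ge> 0" "y = (\<lambda>i. \<Sum>x\<in>A. c x * f i x)"
      unfolding C_def by blast
    have "(\<lambda>i. s * y i) = (\<lambda>i. \<Sum>x\<in>A. (s * c x) * f i x)"
      using A by (simp add: sum_distrib_left mult.assoc)
    moreover have "\<forall>x\<in>A. s * c x \<ge> 0" using A \<open>s \<ge> 0\<close> by auto
    ultimately show "(\<lambda>i. s * y i) \<in> C"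
      unfolding C_def using A by (intro CollectI exI[of _ A] exI[of _ "\<lambda>x. s * c x"]) auto
  qed
  show ?case
  proof (cases "\<exists>y. y \<in> C \<and> (\<forall>i\<in>I. y i = (\<integral>x. f i x \<partial>M))")
    case True
    then obtain A c where "finite A" "A \<subseteq> Y" "\<forall>x\<in>A. c x \<ge> 0"
      "\<forall>i\<in>I. (\<Sum>x\<in>A. c x * f i x) = (\<integral>x. f i x \<partial>M)"
      unfolding C_def by blast
    then show ?thesis by (intro exI[of _ A] exI[of _ c]) auto
  next
    case False
    obtain a where a: "\<exists>i\<in>I. a i \<noteq> 0" "\<forall>y\<in>C. (\<Sum>i\<in>I. a i * y i) \<ge> 0"
      "(\<Sum>i\<in>I. a i * (\<integral>x. f i x \<partial>M)) \<le> 0"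
      by (rule cone_separation[OF psubset.hyps C False]) blast
    define g where "g x = (\<Sum>i\<in>I. a i * f i x)" for x
    have g_int: "integrable M g" unfolding g_def using int by auto
    have g_nonneg: "g x \<ge> 0" if "x \<in> Y" for x
    proof -
      have "(\<lambda>i. f i x) \<in> C"
        unfolding C_def using that by (intro CollectI exI[of _ "{x}"] exI[of _ "\<lambda>_. 1"]) auto
      then show ?thesis using a(2) by (auto simp: g_def)
    qed
    have "(\<integral>x. g x \<partial>M) \<le> 0" unfolding g_def using a(3) int by (simp add: Bochner_Integration.integral_sum)
    moreover have AEg: "AE x in M. 0 \<le> g x"
      using psubset.prems(2) by eventually_elim (rule g_nonneg)
    ultimately have "(\<integral>x. g x \<partial>M) = 0" using integral_nonneg_AE[OF AEg] by linarith
    then have g0: "AE x in M. g x = 0"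
      using integral_nonneg_eq_0_iff_AE[OF g_int AEg] by simp
    obtain j where j: "j \<in> I" "a j \<noteq> 0" using a by blast
    \<comment> \<open>The remaining atoms are confined to the zero set of \<open>g\<close>, where
      the relation among the \<open>f i\<close> holds at every point and not just almost everywhere.
      The same relation then recovers the discarded \<open>f j\<close> both under the integral and
      in the atomic sum.\<close>
    define Y' where "Y' = {x\<in>Y. g x = 0}"
    have "AE x in M. x \<in> Y'" using psubset.prems(2) g0 by eventually_elim (auto simp: Y'_def)
    then have "\<exists>A c. finite A \<and> A \<subseteq> Y' \<and> (\<forall>x\<in>A. c x \<ge> 0) \<and>
      (\<forall>i\<in>I - {j}. (\<integral>x. f i x \<partial>M) = (\<Sum>x\<in>A. c x * f i x))"
      using psubset.IH[of "I - {j}" Y'] j int psubset.prems(3) by (auto simp: Y'_def)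
    then obtain A c where A: "finite A" "A \<subseteq> Y'" "\<forall>x\<in>A. c x \<ge> 0"
      "\<forall>i\<in>I - {j}. (\<integral>x. f i x \<partial>M) = (\<Sum>x\<in>A. c x * f i x)" by blast
    have fj: "f j x = - (\<Sum>i\<in>I - {j}. a i * f i x) / a j" if "g x = 0" for x
    proof -
      have "a j * f j x + (\<Sum>i\<in>I - {j}. a i * f i x) = 0"
        using that j psubset.hyps unfolding g_def by (subst (asm) sum.remove[of _ j]) auto
      then show ?thesis using j by (simp add: field_simps)
    qed
    have "(\<integral>x. f j x \<partial>M) = (\<integral>x. - (\<Sum>i\<in>I - {j}. a i * f i x) / a j \<partial>M)"
    proof (rule integral_cong_AE)
      show "f j \<in> borel_measurable M" using int[OF j(1)] by auto
      show "(\<lambda>x. - (\<Sum>i\<in>I - {j}. a i * f i x) / a j) \<in> borel_measurable M"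
        using int by (auto intro!: borel_measurable_divide borel_measurable_uminus
            borel_measurable_sum borel_measurable_times)
      show "AE x in M. f j x = - (\<Sum>i\<in>I - {j}. a i * f i x) / a j"
        using g0 by eventually_elim (rule fj)
    qed
    also have "\<dots> = - (\<Sum>i\<in>I - {j}. a i * (\<integral>x. f i x \<partial>M)) / a j"
      using int by (simp add: Bochner_Integration.integral_sum)
    also have "\<dots> = - (\<Sum>i\<in>I - {j}. a i * (\<Sum>x\<in>A. c x * f i x)) / a j"
      using A(4) by simp
    also have "\<dots> = (\<Sum>x\<in>A. c x * (- (\<Sum>i\<in>I - {j}. a i * f i x) / a j))"
    proof -
      have "(\<Sum>i\<in>I - {j}. a i * (\<Sum>x\<in>A. c x * f i x)) = (\<Sum>i\<in>I - {j}. \<Sum>x\<in>A. c x * (a i * f i x))"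
        by (simp add: sum_distrib_left mult.left_commute)
      also have "\<dots> = (\<Sum>x\<in>A. \<Sum>i\<in>I - {j}. c x * (a i * f i x))" by (rule sum.swap)
      also have "\<dots> = (\<Sum>x\<in>A. c x * (\<Sum>i\<in>I - {j}. a i * f i x))"
        by (simp only: sum_distrib_left)
      finally show ?thesis
        by (simp add: sum_negf flip: sum_divide_distrib)
    qed
    also have "\<dots> = (\<Sum>x\<in>A. c x * f j x)"
      using A(2) fj by (intro sum.cong) (auto simp: Y'_def)
    finally have "(\<integral>x. f j x \<partial>M) = (\<Sum>x\<in>A. c x * f j x)" .
    then have "\<forall>i\<in>I. (\<integral>x. f i x \<partial>M) = (\<Sum>x\<in>A. c x * f i x)" using A(4) by blast
    then show ?thesis using A by (intro exI[of _ A] exI[of _ c]) (auto simp: Y'_def)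
  qed
qed

subsection \<open>Derivatives of the Stieltjes-Fantappie transform\<close>

definition pairing :: "('n::finite) cpoint \<Rightarrow> real^'n \<Rightarrow> complex" where
  "pairing p x = snd p + (\<Sum>i\<in>UNIV. fst p $ i * complex_of_real (x $ i))"

text \<open>These are the coordinates of (1, x). With them \<open>pairing\<close> is the bilinear
  pairing of the point (z, z0) with (1, x), so differentiation in z0 and in the components of z
  takes the same form.\<close>

definition weight :: "('n::finite) option \<Rightarrow> real^'n \<Rightarrow> real" where
  "weight i x = (case i of None \<Rightarrow> 1 | Some k \<Rightarrow> x $ k)"

text \<open>Up to a constant factor, the moments below are the partial derivatives of the
  Stieltjes-Fantappie transform.\<close>

definition moment :: "(real^'n) measure \<Rightarrow> ('n option \<Rightarrow> nat) \<Rightarrow> ('n::finite) cpoint \<Rightarrow> complex" where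
  "moment M b p = (\<integral>x. complex_of_real (\<Prod>i\<in>UNIV. weight i x ^ b i) /
     pairing p x ^ Suc (\<Sum>i\<in>UNIV. b i) \<partial>M)"

text \<open>The conditions cover both measures on the restricted Borel sets of the dual cone and
  point measures, whose space is the finite set of atoms with all its subsets measurable.\<close>

definition measure_on_dual :: "(real^'n) set \<Rightarrow> (real^'n::finite) measure \<Rightarrow> bool" where
  "measure_on_dual \<Gamma> M \<longleftrightarrow>
     finite_measure M \<and> space M \<subseteq> dual_cone \<Gamma> \<and> (\<lambda>x. x) \<in> M \<rightarrow>\<^sub>M borel"

section \<open>The pairing and its positivity and growth on the tube\<close>

lemma sum_option_UNIV:
  "(\<Sum>i\<in>(UNIV :: 'n::finite option set). f i) = f None + (\<Sum>i\<in>UNIV. f (Some i))"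
  by (simp add: UNIV_option_conv sum.reindex)

lemma coord_eq: "coord None p = snd p" "coord (Some k) p = fst p $ k"
  by (cases p, simp)+

lemma pairing_eq_sum: "pairing p x = (\<Sum>i\<in>UNIV. coord i p * complex_of_real (weight i x))"
  by (simp add: pairing_def weight_def sum_option_UNIV coord_eq)

lemma stieltjes_fantappie_eq: "stieltjes_fantappie M p = (\<integral>x. 1 / pairing p x \<partial>M)"
  by (cases p) (simp add: stieltjes_fantappie_def pairing_def)

lemma stieltjes_fantappie_eq_moment: "stieltjes_fantappie M p = moment M (\<lambda>_. 0) p"
  by (simp add: stieltjes_fantappie_eq moment_def)

lemma pairing_translate:
  "pairing (p + cscale w (coord_vec i)) x = pairing p x + w * complex_of_real (weight i x)"
proof -
  have "coord j (p + cscale w (coord_vec i)) = coord j p + (if j = i then w else 0)" for j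
    by (cases i; cases j) (auto simp: coord_eq cscale_def axis_def)
  then have "pairing (p + cscale w (coord_vec i)) x
      = pairing p x + (\<Sum>j\<in>UNIV. if j = i then w * complex_of_real (weight j x) else 0)"
    unfolding pairing_eq_sum sum.distrib[symmetric] by (intro sum.cong) (auto simp: algebra_simps)
  then show ?thesis by simp
qed

lemma pairing_measurable [measurable]: "pairing p \<in> borel_measurable borel"
  unfolding pairing_def by (intro borel_measurable_continuous_onI continuous_intros)

lemma weight_measurable [measurable]: "weight i \<in> borel_measurable borel"
  unfolding weight_def
  by (cases i) (auto intro!: borel_measurable_continuous_onI continuous_intros)

lemma open_tube:
  fixes \<Gamma> :: "(real^'n::finite) set"
  shows "open (tube \<Gamma>)"
proof -
  have 1: "continuous_on UNIV (\<lambda>p. Re_vec (fst p) :: real^'n)"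
    unfolding Re_vec_def by (intro continuous_intros)
  have 2: "continuous_on UNIV (\<lambda>p::'n cpoint. Re (snd p))"
    by (intro continuous_intros)
  have "tube \<Gamma> = (\<lambda>p. Re_vec (fst p)) -` interior \<Gamma> \<inter> (\<lambda>p. Re (snd p)) -` {0<..}"
    by (auto simp: tube_def)
  then show ?thesis
    using 1 2 by (auto intro!: open_Int open_vimage)
qed

text \<open>A ball of radius \<open>r\<close> about \<open>z\<close> lies in the cone, and
  \<open>x\<close> is tested against the point of this ball that is farthest in the direction of
  \<open>- x\<close>.\<close>

lemma dual_cone_inner_ge:
  fixes \<Gamma> :: "(real^'n) set"
  assumes "z \<in> interior \<Gamma>"
  obtains r where "r > 0" "\<And>x. x \<in> dual_cone \<Gamma> \<Longrightarrow> x \<bullet> z \<ge> r * norm x"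
proof -
  obtain r where r: "r > 0" "cball z r \<subseteq> \<Gamma>"
    using assms mem_interior_cball by blast
  have "x \<bullet> z \<ge> r * norm x" if x: "x \<in> dual_cone \<Gamma>" for x
  proof (cases "x = 0")
    case False
    have "z - (r / norm x) *\<^sub>R x \<in> cball z r" using r False by (simp add: dist_norm)
    then have "0 \<le> x \<bullet> (z - (r / norm x) *\<^sub>R x)" using x r(2) unfolding dual_cone_def by blast
    also have "\<dots> = x \<bullet> z - r * norm x"
      using False by (simp add: inner_diff_right dot_square_norm power2_eq_square)
    finally show ?thesis by simp
  qed simp
  then show thesis using r that by blast
qed

lemma Re_pairing: "Re (pairing p x) = Re (snd p) + x \<bullet> Re_vec (fst p)"
  by (simp add: pairing_def Re_vec_def inner_vec_def mult.commute)

lemma Re_pairing_ge: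
  assumes "p \<in> tube \<Gamma>"
  obtains \<delta> where "\<delta> > 0" "\<And>x. x \<in> dual_cone \<Gamma> \<Longrightarrow> Re (pairing p x) \<ge> \<delta> * (1 + norm x)"
proof -
  have "Re_vec (fst p) \<in> interior \<Gamma>" and 0: "Re (snd p) > 0"
    using assms by (auto simp: tube_def)
  from dual_cone_inner_ge[OF this(1)] obtain r where
    r: "r > 0" "\<And>x. x \<in> dual_cone \<Gamma> \<Longrightarrow> x \<bullet> Re_vec (fst p) \<ge> r * norm x" by blast
  show thesis
  proof (rule that[of "min r (Re (snd p))"])
    fix x assume "x \<in> dual_cone \<Gamma>"
    then have "r * norm x \<le> x \<bullet> Re_vec (fst p)" using r by blast
    moreover have "min r (Re (snd p)) * norm x \<le> r * norm x" by (intro mult_right_mono) auto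
    ultimately show "Re (pairing p x) \<ge> min r (Re (snd p)) * (1 + norm x)"
      by (simp add: Re_pairing distrib_left)
  qed (use r 0 in auto)
qed

lemma Re_pairing_pos: "p \<in> tube \<Gamma> \<Longrightarrow> x \<in> dual_cone \<Gamma> \<Longrightarrow> Re (pairing p x) > 0"
  using interior_subset[of \<Gamma>]
  by (auto simp: Re_pairing tube_def dual_cone_def intro!: add_pos_nonneg)

lemma abs_weight_le: "\<bar>weight i x\<bar> \<le> 1 + norm x"
  using component_le_norm_cart[of x] by (cases i) (auto simp: weight_def add_increasing)

text \<open>Each coordinate of (1, x) is at most 1 + |x| in absolute value, while the pairing is at
  least a constant multiple of 1 + |x|. The bounds are uniform over the unbounded dual cone, which
  yields integrability and domination for every finite measure on it.\<close>

lemma moment_kernel_bounds: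
  assumes "p \<in> tube \<Gamma>"
  obtains R where "R > 0" "\<And>x. x \<in> dual_cone \<Gamma> \<Longrightarrow> cmod (1 / pairing p x) \<le> R"
    "\<And>x i. x \<in> dual_cone \<Gamma> \<Longrightarrow> cmod (complex_of_real (weight i x) / pairing p x) \<le> R"
proof -
  obtain \<delta> where \<delta>: "\<delta> > 0" "\<And>x. x \<in> dual_cone \<Gamma> \<Longrightarrow> Re (pairing p x) \<ge> \<delta> * (1 + norm x)"
    using Re_pairing_ge[OF assms] by blast
  have ge: "cmod (pairing p x) \<ge> \<delta> * (1 + norm x)" if "x \<in> dual_cone \<Gamma>" for x
    using \<delta>(2)[OF that] complex_Re_le_cmod order_trans by blast
  have bound: "cmod (complex_of_real (weight i x) / pairing p x) \<le> 1 / \<delta>"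
    if "x \<in> dual_cone \<Gamma>" for x i
  proof -
    have "cmod (complex_of_real (weight i x) / pairing p x) = \<bar>weight i x\<bar> / cmod (pairing p x)"
      by (simp add: norm_divide)
    also have "\<dots> \<le> (1 + norm x) / (\<delta> * (1 + norm x))"
      using \<delta>(1) by (intro frac_le abs_weight_le ge that) (auto intro!: mult_pos_pos add_pos_nonneg)
    also have "\<dots> = 1 / \<delta>" by (smt (verit) \<delta>(1) norm_ge_zero divide_divide_eq_left' nonzero_divide_mult_cancel_right mult.commute)
    finally show ?thesis .
  qed
  from bound[of _ None] have "cmod (1 / pairing p x) \<le> 1 / \<delta>" if "x \<in> dual_cone \<Gamma>" for x
    using that by (simp add: weight_def)
  then show thesis using that[of "1 / \<delta>"] \<delta>(1) bound by auto
qed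

lemma moment_integrand_bound:
  assumes "\<And>i. cmod (complex_of_real (weight i x) / P) \<le> R" "cmod (1 / P) \<le> R"
  shows "cmod (complex_of_real (\<Prod>i\<in>UNIV. weight i x ^ b i) / P ^ Suc (\<Sum>i\<in>UNIV. b i))
    \<le> R ^ Suc (\<Sum>i\<in>UNIV. b i)"
proof -
  \<comment> \<open>The denominator has one power more than the numerator has factors, so the
    quotient splits into bounded pieces: \<open>1 / P\<close> and one \<open>weight i x / P\<close>
    for each factor.\<close>
  have "complex_of_real (\<Prod>i\<in>UNIV. weight i x ^ b i) / P ^ Suc (\<Sum>i\<in>UNIV. b i)
      = (1 / P) * (\<Prod>i\<in>UNIV. (complex_of_real (weight i x) / P) ^ b i)"
    by (simp add: power_divide prod_dividef power_sum)
  also have "cmod \<dots> \<le> R * (\<Prod>i\<in>UNIV. R ^ b i)"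
    unfolding norm_mult prod_norm[symmetric] norm_power
    using assms by (intro mult_mono prod_mono conjI power_mono) (auto intro: order_trans[OF norm_ge_zero] prod_nonneg)
  finally show ?thesis by (simp add: power_sum)
qed

text \<open>This gives the uniform domination of difference quotients. The constant follows from |1
  / (1 + z)| \<le> 2 and the recursion 2 * 4^m + 2 \<le> 4^(m + 1).\<close>

lemma inverse_power_remainder:
  fixes z :: complex
  assumes "cmod z \<le> 1 / 2"
  shows "cmod (1 / (1 + z) ^ m - 1) \<le> 4 ^ m * cmod z"
proof (induction m)
  case (Suc m)
  have "cmod (1 + z) \<ge> 1 / 2"
    using assms norm_triangle_ineq2[of 1 "- z"] by simp
  then have ne: "1 + z \<noteq> 0" by auto
  have inv: "cmod (1 / (1 + z)) \<le> 2"
    using frac_le[of 1 1 "1 / 2" "cmod (1 + z)"] \<open>cmod (1 + z) \<ge> 1 / 2\<close> by (simp add: norm_divide)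
  have "1 / (1 + z) ^ Suc m - 1 = (1 / (1 + z) ^ m - 1) * (1 / (1 + z)) - z * (1 / (1 + z))"
  proof -
    have *: "(a - 1) * v - z * v = a * v - (1 + z) * v" for a v by (simp add: algebra_simps)
    have e: "1 / (1 + z) ^ Suc m = (1 / (1 + z) ^ m) * (1 / (1 + z))" "(1 + z) * (1 / (1 + z)) = 1"
      using ne by simp_all
    show ?thesis unfolding e(1) * e(2) ..
  qed
  also have "cmod \<dots> \<le> (4 ^ m * cmod z) * 2 + cmod z * 2"
  proof (intro order_trans[OF norm_triangle_ineq4] add_mono)
    show "cmod ((1 / (1 + z) ^ m - 1) * (1 / (1 + z))) \<le> (4 ^ m * cmod z) * 2"
      unfolding norm_mult by (rule mult_mono[OF Suc inv]) simp_all
    show "cmod (z * (1 / (1 + z))) \<le> cmod z * 2"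
      unfolding norm_mult by (rule mult_left_mono[OF inv]) simp
  qed
  also have "\<dots> = (4 ^ m * 2 + 2) * cmod z" by (simp add: algebra_simps)
  also have "\<dots> \<le> 4 ^ Suc m * cmod z"
    by (intro mult_right_mono) auto
  finally show ?case .
qed simp

text \<open>Factoring the unperturbed pairing out of a moment leaves exactly this dependence on the
  increment \<open>w\<close> of one coordinate, with \<open>u\<close> bounded. Differentiation under
  the integral is dominated convergence along sequences, with a constant as dominating
  function.\<close>

lemma has_field_derivative_integral_inverse_power:
  fixes g u :: "'a \<Rightarrow> complex"
  assumes "finite_measure M" and [measurable]: "g \<in> borel_measurable M" "u \<in> borel_measurable M"
    and g: "\<And>x. x \<in> space M \<Longrightarrow> cmod (g x) \<le> G" and u: "\<And>x. x \<in> space M \<Longrightarrow> cmod (u x) \<le> R"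
    and R: "R > 0"
  shows "((\<lambda>w. \<integral>x. g x / (1 + w * u x) ^ m \<partial>M) has_field_derivative
    (\<integral>x. - of_nat m * u x * g x \<partial>M)) (at 0)"
  unfolding has_field_derivative_iff tendsto_at_iff_sequentially
proof (intro allI impI)
  interpret finite_measure M by fact
  fix X :: "nat \<Rightarrow> complex"
  assume X0: "\<forall>i. X i \<in> UNIV - {0}" and X: "X \<longlonglongrightarrow> 0"
  define q where "q w x = (g x / (1 + w * u x) ^ m - g x) / w" for w x
  \<comment> \<open>The radius \<open>1 / (2 * R)\<close> ensures
    \<open>cmod (X n * u x) \<le> 1 / 2\<close>, where the remainder estimate applies. Domination
    thus starts only at the index \<open>N\<close>, and the limits are taken along the shifted
    sequence.\<close>
  have "eventually (\<lambda>n. cmod (X n) < 1 / (2 * R)) sequentially"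
    using tendstoD[OF X, of "1 / (2 * R)"] R by (simp add: dist_norm)
  then obtain N where N: "\<And>n. n \<ge> N \<Longrightarrow> cmod (X n) < 1 / (2 * R)"
    by (auto simp: eventually_sequentially)
  have small: "cmod (X n * u x) \<le> 1 / 2" if "n \<ge> N" "x \<in> space M" for n x
  proof -
    have "cmod (X n * u x) \<le> 1 / (2 * R) * R"
      unfolding norm_mult using N[OF that(1)] u[OF that(2)] R by (intro mult_mono) auto
    then show ?thesis using R by simp
  qed
  have bound: "cmod (q (X n) x) \<le> G * (4 ^ m * R)" if "n \<ge> N" "x \<in> space M" for n x
  proof -
    have Xn: "cmod (X n) > 0" using X0 by auto
    have "q (X n) x = g x * ((1 / (1 + X n * u x) ^ m - 1) / X n)"
      by (simp add: q_def right_diff_distrib)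
    also have "cmod \<dots> \<le> G * (4 ^ m * R)"
      unfolding norm_mult norm_divide
    proof (rule mult_mono[OF g[OF that(2)]])
      have "cmod (1 / (1 + X n * u x) ^ m - 1) \<le> 4 ^ m * cmod (X n * u x)"
        by (rule inverse_power_remainder[OF small[OF that]])
      also have "\<dots> \<le> (4 ^ m * R) * cmod (X n)"
        using mult_left_mono[OF u[OF that(2)], of "4 ^ m * cmod (X n)"] by (simp add: norm_mult ac_simps)
      finally show "cmod (1 / (1 + X n * u x) ^ m - 1) / cmod (X n) \<le> 4 ^ m * R"
        using Xn by (simp add: divide_le_eq)
      show "0 \<le> G" using g[OF that(2)] norm_ge_zero order_trans by blast
    qed simp
    finally show ?thesis .
  qed
  have lim: "(\<lambda>n. q (X (n + N)) x) \<longlonglongrightarrow> - of_nat m * u x * g x" for x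
  proof -
    have "((\<lambda>w. g x / (1 + w * u x) ^ m) has_field_derivative - of_nat m * u x * g x) (at 0)"
      by (auto intro!: derivative_eq_intros)
    then have "((\<lambda>w. q w x) \<longlongrightarrow> - of_nat m * u x * g x) (at 0)"
      by (simp add: has_field_derivative_iff q_def)
    then have "(\<lambda>n. q (X n) x) \<longlonglongrightarrow> - of_nat m * u x * g x"
      using X0 X unfolding tendsto_at_iff_sequentially by (auto simp: o_def)
    then show ?thesis by (rule LIMSEQ_ignore_initial_segment)
  qed
  have lim2: "(\<lambda>n. \<integral>x. q (X (n + N)) x \<partial>M) \<longlonglongrightarrow> (\<integral>x. - of_nat m * u x * g x \<partial>M)"
  proof (rule integral_dominated_convergence[where w = "\<lambda>_. G * (4 ^ m * R)"])
    show "AE x in M. (\<lambda>n. q (X (n + N)) x) \<longlonglongrightarrow> - of_nat m * u x * g x" using lim by simp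
    show "AE x in M. norm (q (X (n + N)) x) \<le> G * (4 ^ m * R)" for n
      using bound[of "n + N"] by (auto intro!: AE_I2)
    show "(\<lambda>x. q (X (n + N)) x) \<in> borel_measurable M" for n unfolding q_def by measurable
  qed auto
  have "(\<integral>x. q (X n) x \<partial>M)
      = ((\<integral>x. g x / (1 + X n * u x) ^ m \<partial>M) - (\<integral>x. g x / (1 + 0 * u x) ^ m \<partial>M)) / (X n - 0)"
    if n: "n \<ge> N" for n
  proof -
    have ig: "integrable M g"
      by (rule integrable_const_bound[of _ G]) (use g in \<open>auto intro!: AE_I2\<close>)
    have "integrable M (\<lambda>x. g x / (1 + X n * u x) ^ m)"
    proof (rule integrable_const_bound[of _ "G * (4 ^ m * (1 / 2) + 1)"])
      have "cmod (g x / (1 + X n * u x) ^ m) \<le> G * (4 ^ m * (1 / 2) + 1)" if x: "x \<in> space M" for x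
      proof -
        have *: "cmod (1 / (1 + X n * u x) ^ m - 1) \<le> 4 ^ m * (1 / 2)"
          using inverse_power_remainder[OF small[OF n x], of m] small[OF n x]
          by (meson mult_left_mono order_trans zero_le_numeral zero_le_power)
        have "cmod (1 / (1 + X n * u x) ^ m) \<le> 4 ^ m * (1 / 2) + 1"
          using * norm_triangle_sub[of "1 / (1 + X n * u x) ^ m" 1] by simp
        then have "cmod (g x) * cmod (1 / (1 + X n * u x) ^ m) \<le> G * (4 ^ m * (1 / 2) + 1)"
          using g[OF x] order_trans[OF norm_ge_zero g[OF x]] by (intro mult_mono) auto
        then show ?thesis by (simp add: norm_mult[symmetric])
      qed
      then show "AE x in M. norm (g x / (1 + X n * u x) ^ m) \<le> G * (4 ^ m * (1 / 2) + 1)" by auto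
    qed measurable
    then show ?thesis using ig by (simp add: q_def)
  qed
  then have lim3: "(\<lambda>n. (((\<integral>x. g x / (1 + X (n + N) * u x) ^ m \<partial>M) - (\<integral>x. g x / (1 + 0 * u x) ^ m \<partial>M))
      / (X (n + N) - 0))) \<longlonglongrightarrow> (\<integral>x. - of_nat m * u x * g x \<partial>M)"
    using lim2 by simp
  show "((\<lambda>y. ((\<integral>x. g x / (1 + y * u x) ^ m \<partial>M) - (\<integral>x. g x / (1 + 0 * u x) ^ m \<partial>M)) / (y - 0)) \<circ> X)
      \<longlonglongrightarrow> (\<integral>x. - of_nat m * u x * g x \<partial>M)"
    by (rule LIMSEQ_offset[of _ N]) (use lim3 in \<open>simp add: o_def\<close>)
qed

section \<open>Partial derivatives of the moments\<close>

lemma measure_on_dual_measurable: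
  assumes "measure_on_dual \<Gamma> M" "f \<in> borel_measurable borel"
  shows "f \<in> borel_measurable M"
  by (rule measurable_compose[of "\<lambda>x. x" M borel f borel])
    (use assms in \<open>auto simp: measure_on_dual_def\<close>)

lemma integrable_moment:
  assumes M: "measure_on_dual \<Gamma> M" and p: "p \<in> tube \<Gamma>"
  shows "integrable M (\<lambda>x. complex_of_real (\<Prod>i\<in>UNIV. weight i x ^ b i) /
     pairing p x ^ Suc (\<Sum>i\<in>UNIV. b i))"
proof -
  interpret finite_measure M using M by (simp add: measure_on_dual_def)
  obtain R where R: "R > 0" "\<And>x. x \<in> dual_cone \<Gamma> \<Longrightarrow> cmod (1 / pairing p x) \<le> R"
    "\<And>x i. x \<in> dual_cone \<Gamma> \<Longrightarrow> cmod (complex_of_real (weight i x) / pairing p x) \<le> R"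
    using moment_kernel_bounds[OF p] by blast
  show ?thesis
  proof (rule integrable_const_bound[of _ "R ^ Suc (\<Sum>i\<in>UNIV. b i)"])
    show "AE x in M. norm (complex_of_real (\<Prod>i\<in>UNIV. weight i x ^ b i) /
        pairing p x ^ Suc (\<Sum>i\<in>UNIV. b i)) \<le> R ^ Suc (\<Sum>i\<in>UNIV. b i)"
      using M by (intro AE_I2 moment_integrand_bound R) (auto simp: measure_on_dual_def)
    show "(\<lambda>x. complex_of_real (\<Prod>i\<in>UNIV. weight i x ^ b i) /
        pairing p x ^ Suc (\<Sum>i\<in>UNIV. b i)) \<in> borel_measurable M"
      by (rule measure_on_dual_measurable[OF M]) measurable
  qed
qed

text \<open>Each differentiation adds one factor \<open>weight i x\<close> and one power of the
  pairing, so the family of moments is closed under it up to constants. Equality of \<open>f\<close>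
  with the moment is assumed only on the tube, because this is all that is known of a previously
  computed derivative.\<close>

lemma partial_deriv_moment:
  fixes p :: "('n::finite) cpoint"
  assumes M: "measure_on_dual \<Gamma> M" and p: "p \<in> tube \<Gamma>"
    and f: "\<And>q. q \<in> tube \<Gamma> \<Longrightarrow> f q = K * moment M b q"
  shows "partial_deriv i f p
    = K * (- of_nat (Suc (\<Sum>k\<in>UNIV. b k))) * moment M (b(i := Suc (b i))) p"
proof -
  define m where "m = Suc (\<Sum>k\<in>UNIV. b k)"
  define g where "g x = complex_of_real (\<Prod>i\<in>UNIV. weight i x ^ b i) / pairing p x ^ m" for x
  define u where "u x = complex_of_real (weight i x) / pairing p x" for x
  obtain R where R: "R > 0" "\<And>x. x \<in> dual_cone \<Gamma> \<Longrightarrow> cmod (1 / pairing p x) \<le> R"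
    "\<And>x i. x \<in> dual_cone \<Gamma> \<Longrightarrow> cmod (complex_of_real (weight i x) / pairing p x) \<le> R"
    using moment_kernel_bounds[OF p] by blast
  have sp: "x \<in> dual_cone \<Gamma>" if "x \<in> space M" for x using that M by (auto simp: measure_on_dual_def)
  have ne: "pairing p x \<noteq> 0" if "x \<in> space M" for x
    using Re_pairing_pos[OF p sp[OF that]] by auto
  have "((\<lambda>w. \<integral>x. g x / (1 + w * u x) ^ m \<partial>M) has_field_derivative
      (\<integral>x. - of_nat m * u x * g x \<partial>M)) (at 0)"
  proof (rule has_field_derivative_integral_inverse_power[where G = "R ^ m" and R = R])
    show "finite_measure M" using M by (simp add: measure_on_dual_def)
    show "g \<in> borel_measurable M" "u \<in> borel_measurable M"
      unfolding g_def u_def by (rule measure_on_dual_measurable[OF M], measurable)+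
    show "cmod (g x) \<le> R ^ m" if "x \<in> space M" for x
      unfolding g_def m_def using R sp[OF that] by (intro moment_integrand_bound) auto
    show "cmod (u x) \<le> R" if "x \<in> space M" for x
      unfolding u_def using R sp[OF that] by auto
  qed (use R in auto)
  moreover have "(\<integral>x. g x / (1 + w * u x) ^ m \<partial>M) = moment M b (p + cscale w (coord_vec i))" for w
    unfolding moment_def
  proof (rule Bochner_Integration.integral_cong[OF refl])
    fix x assume x: "x \<in> space M"
    have "pairing (p + cscale w (coord_vec i)) x = pairing p x * (1 + w * u x)"
      using ne[OF x] by (simp add: pairing_translate u_def field_simps)
    then show "g x / (1 + w * u x) ^ m = complex_of_real (\<Prod>i\<in>UNIV. weight i x ^ b i) /
        pairing (p + cscale w (coord_vec i)) x ^ Suc (\<Sum>i\<in>UNIV. b i)"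
      by (simp add: g_def m_def power_mult_distrib)
  qed
  moreover have "(\<integral>x. - of_nat m * u x * g x \<partial>M) = - of_nat m * moment M (b(i := Suc (b i))) p"
  proof -
    have sum: "(\<Sum>k\<in>UNIV. (b(i := Suc (b i))) k) = m"
      by (simp add: m_def sum.remove[of UNIV i])
    have "- of_nat m * u x * g x = - of_nat m * (complex_of_real (\<Prod>k\<in>UNIV. weight k x ^ (b(i := Suc (b i))) k)
        / pairing p x ^ Suc (\<Sum>k\<in>UNIV. (b(i := Suc (b i))) k))" for x
      unfolding sum by (simp add: u_def g_def prod.remove[of UNIV i])
    then show ?thesis unfolding moment_def by (simp only: integral_mult_right_zero)
  qed
  ultimately have "((\<lambda>w. moment M b (p + cscale w (coord_vec i))) has_field_derivative
      - of_nat m * moment M (b(i := Suc (b i))) p) (at 0)" by simp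
  then have D: "((\<lambda>w. K * moment M b (p + cscale w (coord_vec i))) has_field_derivative
      K * (- of_nat m * moment M (b(i := Suc (b i))) p)) (at 0)" by (rule DERIV_cmult)
  \<comment> \<open>Small increments stay in the open tube, so \<open>f\<close> may be exchanged
    with the moment near 0.\<close>
  have cont: "continuous_on UNIV (\<lambda>w. p + cscale w (coord_vec i))"
    unfolding cscale_def vector_scalar_mult_def by (intro continuous_intros)
  have op: "open ((\<lambda>w. p + cscale w (coord_vec i)) -` tube \<Gamma>)"
    using cont open_tube by (intro open_vimage)
  have "(0::complex) \<in> (\<lambda>w. p + cscale w (coord_vec i)) -` tube \<Gamma>"
    using p by (simp add: cscale_def flip: zero_prod_def)
  from has_field_derivative_transform_within_open[OF D op this]
  have "((\<lambda>w. f (p + cscale w (coord_vec i))) has_field_derivative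
      K * (- of_nat m * moment M (b(i := Suc (b i))) p)) (at 0)"
    using f by auto
  then show ?thesis
    unfolding partial_deriv_def m_def[symmetric] mult.assoc by (rule DERIV_imp_deriv)
qed

text \<open>The order of the quantifiers matters: \<open>b'\<close> and \<open>K'\<close> are chosen
  before \<open>M\<close>. The same formula therefore serves two different measures, and equal
  moments give equal derivatives.\<close>

lemma partial_derivs_moment:
  fixes K :: complex
  shows "\<exists>b' K'. (\<Sum>k\<in>UNIV. b' k) = (\<Sum>k\<in>UNIV. b k) + r \<and>
    (\<forall>M f. measure_on_dual \<Gamma> M \<longrightarrow> (\<forall>q\<in>tube \<Gamma>. f q = K * moment M b q) \<longrightarrow>
       (\<forall>q\<in>tube \<Gamma>. (partial_deriv i ^^ r) f q = K' * moment M b' q))"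
proof (induction r)
  case 0
  show ?case by (rule exI[of _ b], rule exI[of _ K]) simp
next
  case (Suc r)
  then obtain b' K' where IH: "(\<Sum>k\<in>UNIV. b' k) = (\<Sum>k\<in>UNIV. b k) + r"
    "\<And>M f q. measure_on_dual \<Gamma> M \<Longrightarrow> (\<forall>q\<in>tube \<Gamma>. f q = K * moment M b q) \<Longrightarrow> q \<in> tube \<Gamma> \<Longrightarrow>
       (partial_deriv i ^^ r) f q = K' * moment M b' q" by blast
  show ?case
  proof (intro exI conjI allI impI ballI)
    show "(\<Sum>k\<in>UNIV. (b'(i := Suc (b' i))) k) = (\<Sum>k\<in>UNIV. b k) + Suc r"
      using IH(1) by (simp add: sum.remove[of UNIV i])
    fix M f q
    assume *: "measure_on_dual \<Gamma> M" "\<forall>q\<in>tube \<Gamma>. f q = K * moment M b q" "q \<in> tube \<Gamma>"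
    show "(partial_deriv i ^^ Suc r) f q
      = K' * (- of_nat (Suc (\<Sum>k\<in>UNIV. b' k))) * moment M (b'(i := Suc (b' i))) q"
      using partial_deriv_moment[OF *(1,3) IH(2)[OF *(1,2)]] by simp
  qed
qed

text \<open>Only the total order of \<open>b\<close> is recorded. This is enough, since the measures
  compared later agree on the moments of all multi-indices up to a given total order. The constant
  \<open>K\<close> is common to all measures.\<close>

lemma multi_deriv_stieltjes_fantappie:
  fixes \<alpha> :: "('n::finite) option \<Rightarrow> nat"
  shows "\<exists>b K. (\<Sum>k\<in>UNIV. b k) = (\<Sum>k\<in>UNIV. \<alpha> k) \<and>
    (\<forall>M. measure_on_dual \<Gamma> M \<longrightarrow>
       (\<forall>q\<in>tube \<Gamma>. multi_deriv \<alpha> (stieltjes_fantappie M) q = K * moment M b q))"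
proof -
  have step: "\<exists>b K. (\<Sum>k\<in>UNIV. b k) = (\<Sum>k\<leftarrow>xs. \<alpha> k) \<and>
    (\<forall>M. measure_on_dual \<Gamma> M \<longrightarrow> (\<forall>q\<in>tube \<Gamma>.
       foldr (\<lambda>i. partial_deriv i ^^ \<alpha> i) xs (stieltjes_fantappie M) q = K * moment M b q))" for xs
  proof (induction xs)
    case Nil
    show ?case
      by (intro exI[of _ "\<lambda>_. 0"] exI[of _ 1]) (simp add: stieltjes_fantappie_eq_moment)
  next
    case (Cons i xs)
    then obtain b K where IH: "(\<Sum>k\<in>UNIV. b k) = (\<Sum>k\<leftarrow>xs. \<alpha> k)"
      "\<And>M. measure_on_dual \<Gamma> M \<Longrightarrow> (\<forall>q\<in>tube \<Gamma>.
         foldr (\<lambda>i. partial_deriv i ^^ \<alpha> i) xs (stieltjes_fantappie M) q = K * moment M b q)"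
      by blast
    obtain b' K' where "(\<Sum>k\<in>UNIV. b' k) = (\<Sum>k\<in>UNIV. b k) + \<alpha> i"
      "\<And>M f. measure_on_dual \<Gamma> M \<Longrightarrow> (\<forall>q\<in>tube \<Gamma>. f q = K * moment M b q) \<Longrightarrow>
         (\<forall>q\<in>tube \<Gamma>. (partial_deriv i ^^ \<alpha> i) f q = K' * moment M b' q)"
      using partial_derivs_moment[of b "\<alpha> i" \<Gamma> K i] by blast
    then show ?case using IH by (intro exI[of _ b'] exI[of _ K']) auto
  qed
  have "distinct (coord_list :: 'n option list) \<and> set (coord_list :: 'n option list) = UNIV"
    unfolding coord_list_def using finite_distinct_list[of "UNIV :: 'n option set"]
    by (metis (mono_tags, lifting) finite_class.finite_UNIV someI_ex)
  then have sum: "(\<Sum>k\<leftarrow>coord_list. \<alpha> k) = (\<Sum>k\<in>UNIV. \<alpha> k)"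
    using sum_list_distinct_conv_sum_set by metis
  show ?thesis using step[of coord_list] unfolding sum multi_deriv_def .
qed

subsection \<open>Measures with finitely many atoms\<close>

text \<open>Terms are grouped by their exponents. The free index set lets sums and products of
  polynomials be written over disjoint unions and Cartesian products, although different indices may
  yield the same monomial.\<close>

lemma cpolynomial_monomial_sum:
  assumes "finite S" and "\<And>p. P p = (\<Sum>k\<in>S. c k * (\<Prod>i\<in>UNIV. coord i p ^ e k i))"
  shows "cpolynomial P"
  unfolding cpolynomial_def
proof (intro exI conjI allI)
  show "finite (e ` S)" using assms(1) by simp
  fix p
  have "P p = (\<Sum>\<alpha>\<in>e ` S. \<Sum>k\<in>{k\<in>S. e k = \<alpha>}. c k * (\<Prod>i\<in>UNIV. coord i p ^ e k i))"
    unfolding assms(2) by (rule sum.image_gen[OF assms(1)])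
  also have "\<dots> = (\<Sum>\<alpha>\<in>e ` S. (\<Sum>k\<in>{k\<in>S. e k = \<alpha>}. c k) * (\<Prod>i\<in>UNIV. coord i p ^ \<alpha> i))"
    unfolding sum_distrib_right by (intro sum.cong) auto
  finally show "P p = \<dots>" .
qed

lemma cpolynomialE:
  assumes "cpolynomial P"
  obtains A c where "finite A" "\<And>p. P p = (\<Sum>\<alpha>\<in>A. c \<alpha> * (\<Prod>i\<in>UNIV. coord i p ^ \<alpha> i))"
  using assms unfolding cpolynomial_def by (elim exE conjE) auto

lemma cpolynomial_const: "cpolynomial (\<lambda>p. a)"
  by (rule cpolynomial_monomial_sum[of "{()}" _ "\<lambda>_. a" "\<lambda>_ _. 0"]) auto

lemma cpolynomial_coord: "cpolynomial (coord j)"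
  by (rule cpolynomial_monomial_sum[of "{()}" _ "\<lambda>_. 1" "\<lambda>_ i. if i = j then 1 else 0"])
    (auto simp: if_distrib[of "\<lambda>n. _ ^ n"] cong: if_cong)

lemma cpolynomial_add:
  assumes "cpolynomial P" "cpolynomial Q"
  shows "cpolynomial (\<lambda>p. P p + Q p)"
proof -
  obtain A c where A: "finite A" "\<And>p. P p = (\<Sum>\<alpha>\<in>A. c \<alpha> * (\<Prod>i\<in>UNIV. coord i p ^ \<alpha> i))"
    using assms(1) by (rule cpolynomialE) auto
  obtain B d where B: "finite B" "\<And>p. Q p = (\<Sum>\<alpha>\<in>B. d \<alpha> * (\<Prod>i\<in>UNIV. coord i p ^ \<alpha> i))"
    using assms(2) by (rule cpolynomialE) auto
  show ?thesis
    by (rule cpolynomial_monomial_sum[of "A <+> B" _ "case_sum c d" "case_sum id id"])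
      (auto simp: A B sum.Plus)
qed

lemma cpolynomial_mult:
  assumes "cpolynomial P" "cpolynomial Q"
  shows "cpolynomial (\<lambda>p. P p * Q p)"
proof -
  obtain A c where A: "finite A" "\<And>p. P p = (\<Sum>\<alpha>\<in>A. c \<alpha> * (\<Prod>i\<in>UNIV. coord i p ^ \<alpha> i))"
    using assms(1) by (rule cpolynomialE) auto
  obtain B d where B: "finite B" "\<And>p. Q p = (\<Sum>\<alpha>\<in>B. d \<alpha> * (\<Prod>i\<in>UNIV. coord i p ^ \<alpha> i))"
    using assms(2) by (rule cpolynomialE) auto
  show ?thesis
  proof (rule cpolynomial_monomial_sum[of "A \<times> B" _ "\<lambda>(\<alpha>, \<beta>). c \<alpha> * d \<beta>" "\<lambda>(\<alpha>, \<beta>) i. \<alpha> i + \<beta> i"])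
    fix p
    have "P p * Q p = (\<Sum>k\<in>A \<times> B. case k of (\<alpha>, \<beta>) \<Rightarrow>
        (c \<alpha> * (\<Prod>i\<in>UNIV. coord i p ^ \<alpha> i)) * (d \<beta> * (\<Prod>i\<in>UNIV. coord i p ^ \<beta> i)))"
      by (simp add: A B sum_product sum.cartesian_product)
    also have "\<dots> = (\<Sum>k\<in>A \<times> B. (case k of (\<alpha>, \<beta>) \<Rightarrow> c \<alpha> * d \<beta>) *
        (\<Prod>i\<in>UNIV. coord i p ^ (case k of (\<alpha>, \<beta>) \<Rightarrow> \<lambda>i. \<alpha> i + \<beta> i) i))"
      by (intro sum.cong) (auto simp: power_add prod.distrib)
    finally show "P p * Q p = \<dots>" .
  qed (use A B in auto)
qed

lemma cpolynomial_sum: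
  "finite S \<Longrightarrow> (\<And>k. k \<in> S \<Longrightarrow> cpolynomial (P k)) \<Longrightarrow> cpolynomial (\<lambda>p. \<Sum>k\<in>S. P k p)"
  by (induction S rule: finite_induct) (auto intro: cpolynomial_const cpolynomial_add)

lemma cpolynomial_pairing: "cpolynomial (\<lambda>p. pairing p x)"
  unfolding pairing_eq_sum
  by (intro cpolynomial_sum cpolynomial_mult cpolynomial_const cpolynomial_coord) auto

section \<open>Atomic transforms as rational functions on the tube and along directions\<close>

lemma rational_on_add:
  assumes "rational_on f S" "rational_on g S"
  shows "rational_on (\<lambda>p. f p + g p) S"
proof -
  obtain P Q where PQ: "cpolynomial P" "cpolynomial Q"
    and f: "\<forall>p\<in>S. Q p \<noteq> 0 \<and> f p = P p / Q p"
    using assms(1) unfolding rational_on_def by blast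
  obtain P' Q' where PQ': "cpolynomial P'" "cpolynomial Q'"
    and g: "\<forall>p\<in>S. Q' p \<noteq> 0 \<and> g p = P' p / Q' p"
    using assms(2) unfolding rational_on_def by blast
  from PQ PQ' have "cpolynomial (\<lambda>p. P p * Q' p + P' p * Q p)" "cpolynomial (\<lambda>p. Q p * Q' p)"
    by (auto intro: cpolynomial_add cpolynomial_mult)
  moreover have "\<forall>p\<in>S. Q p * Q' p \<noteq> 0 \<and> f p + g p = (P p * Q' p + P' p * Q p) / (Q p * Q' p)"
    using f g by (auto simp: add_frac_eq)
  ultimately show ?thesis unfolding rational_on_def by blast
qed

lemma rational_on_atomic:
  assumes "finite A" "\<And>p x. p \<in> S \<Longrightarrow> x \<in> A \<Longrightarrow> pairing p x \<noteq> 0"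
  shows "rational_on (\<lambda>p. \<Sum>x\<in>A. complex_of_real (c x) / pairing p x) S"
  using assms
proof (induction A rule: finite_induct)
  case empty
  show ?case unfolding rational_on_def
    by (intro exI[of _ "\<lambda>_. 0"] exI[of _ "\<lambda>_. 1"]) (auto intro: cpolynomial_const)
next
  case (insert x A)
  have "rational_on (\<lambda>p. complex_of_real (c x) / pairing p x) S"
    unfolding rational_on_def
    by (intro exI[of _ "\<lambda>_. complex_of_real (c x)"] exI[of _ "\<lambda>p. pairing p x"])
      (use insert.prems in \<open>auto intro: cpolynomial_const cpolynomial_pairing\<close>)
  then show ?case using insert by (auto intro: rational_on_add)
qed

lemma pairing_directional:
  "pairing (complex_vec \<omega>, z0) x = z0 + complex_of_real (x \<bullet> \<omega>)"
  by (simp add: pairing_def complex_vec_def inner_vec_def mult.commute)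

lemma pairing_nonzero:
  assumes "p \<in> tube \<Gamma> \<union> directional_points \<Gamma>" "x \<in> dual_cone \<Gamma>"
  shows "pairing p x \<noteq> 0"
proof (cases "p \<in> tube \<Gamma>")
  case True
  then show ?thesis using Re_pairing_pos[OF _ assms(2)] by fastforce
next
  case False
  then obtain \<omega> z0 where *: "p = (complex_vec \<omega>, z0)" "\<omega> \<in> \<Gamma>" "Re z0 > 0"
    using assms(1) by (auto simp: directional_points_def)
  then have "x \<bullet> \<omega> \<ge> 0" using assms(2) by (auto simp: dual_cone_def)
  then have "Re (pairing p x) > 0" using * by (simp add: pairing_directional)
  then show ?thesis by fastforce
qed

text \<open>Taking reciprocals preserves the right half-plane, and the pairing maps the tube into it
  for every atom in the dual cone. Complex linearity of the derivative is inherited from the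
  pairing.\<close>

lemma herglotz_nevanlinna_on_atomic:
  assumes "finite A" "A \<subseteq> dual_cone \<Gamma>" "\<forall>x\<in>A. c x \<ge> 0"
  shows "herglotz_nevanlinna_on (\<lambda>p. \<Sum>x\<in>A. complex_of_real (c x) / pairing p x) (tube \<Gamma>)"
  unfolding herglotz_nevanlinna_on_def sv_holomorphic_on_def
proof (intro conjI ballI)
  fix p :: "'a cpoint" assume p: "p \<in> tube \<Gamma>"
  have pos: "Re (pairing p x) > 0" if "x \<in> A" for x
    using Re_pairing_pos[OF p] that assms by auto
  have "Re (complex_of_real (c x) / pairing p x) \<ge> 0" if "x \<in> A" for x
    using assms(3) pos[OF that] that by (auto simp: Re_divide intro!: divide_nonneg_nonneg mult_nonneg_nonneg)
  then show "Re (\<Sum>x\<in>A. complex_of_real (c x) / pairing p x) \<ge> 0"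
    by (auto intro: sum_nonneg)
  have lin: "bounded_linear (\<lambda>p::'a cpoint. pairing p x)" for x
    unfolding pairing_def
    by (intro bounded_linear_intros bounded_linear_sum) (auto intro!: bounded_linear_intros bounded_linear_compose[OF bounded_linear_vec_nth])
  have "((\<lambda>p. \<Sum>x\<in>A. complex_of_real (c x) / pairing p x) has_derivative
      (\<lambda>h. \<Sum>x\<in>A. - complex_of_real (c x) * pairing h x / (pairing p x)\<^sup>2)) (at p)"
  proof (rule has_derivative_sum)
    fix x assume x: "x \<in> A"
    then have ne: "pairing p x \<noteq> 0" using pos by fastforce
    show "((\<lambda>p. complex_of_real (c x) / pairing p x) has_derivative
        (\<lambda>h. - complex_of_real (c x) * pairing h x / (pairing p x)\<^sup>2)) (at p)"
      by (rule has_derivative_eq_rhs[OF has_derivative_divide'[OF has_derivative_const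
            bounded_linear_imp_has_derivative[OF lin] ne]])
        (simp add: power2_eq_square fun_eq_iff)
  qed
  moreover have "pairing (cscale w h) x = w * pairing h x" for w :: complex and h :: "'a cpoint" and x
    by (simp add: pairing_def cscale_def distrib_left sum_distrib_left mult.assoc)
  ultimately show "\<exists>D. ((\<lambda>p. \<Sum>x\<in>A. complex_of_real (c x) / pairing p x) has_derivative D) (at p) \<and>
      (\<forall>w h. D (cscale w h) = w * D h)"
    by (intro exI conjI) (assumption, simp add: sum_distrib_left mult.left_commute)
qed

text \<open>An atom \<open>x\<close> contributes the term with \<gamma> =
  \<open>x \<bullet> \<omega>\<close>, which is nonnegative by duality also for
  \<open>\<omega>\<close> on the boundary. The masses and their enumeration are the same for all
  directions.\<close>

lemma directional_stieltjes_sum_atomic: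
  assumes "finite A" "A \<subseteq> dual_cone \<Gamma>" "\<forall>x\<in>A. c x \<ge> 0"
  shows "directional_stieltjes_sum \<Gamma> (\<lambda>p. \<Sum>x\<in>A. complex_of_real (c x) / pairing p x)"
  unfolding directional_stieltjes_sum_def
proof
  fix \<omega> assume \<omega>: "\<omega> \<in> \<Gamma>"
  obtain h where h: "bij_betw h {1..card A} A" using ex_bij_betw_nat_finite_1[OF assms(1)] by blast
  show "\<exists>(N::nat) c' \<gamma>. (\<forall>j\<in>{1..N}. 0 \<le> c' j \<and> 0 \<le> \<gamma> j) \<and>
      (\<forall>t z0. 0 \<le> t \<longrightarrow> 0 < Re z0 \<longrightarrow>
         (\<Sum>x\<in>A. complex_of_real (c x) / pairing (complex_vec (t *\<^sub>R \<omega>), z0) x) =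
         (\<Sum>j = 1..N. complex_of_real (c' j) / (z0 + complex_of_real (t * \<gamma> j))))"
  proof (intro exI conjI allI impI ballI)
    fix j assume "j \<in> {1..card A}"
    then have "h j \<in> A" using h by (auto simp: bij_betw_def)
    then show "0 \<le> (c \<circ> h) j" "0 \<le> ((\<lambda>x. x \<bullet> \<omega>) \<circ> h) j" using assms \<omega> by (auto simp: dual_cone_def)
  next
    fix t :: real and z0
    show "(\<Sum>x\<in>A. complex_of_real (c x) / pairing (complex_vec (t *\<^sub>R \<omega>), z0) x) =
        (\<Sum>j = 1..card A. complex_of_real ((c \<circ> h) j) /
           (z0 + complex_of_real (t * ((\<lambda>x. x \<bullet> \<omega>) \<circ> h) j)))"
      by (subst sum.reindex_bij_betw[OF h, symmetric]) (simp add: pairing_directional)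
  qed
qed

section \<open>Atoms with prescribed moments at the real point\<close>

lemma finite_bounded_multiindices: "finite {b :: ('i::finite) \<Rightarrow> nat. (\<Sum>i\<in>UNIV. b i) \<le> n}"
proof (rule finite_subset)
  show "{b :: 'i \<Rightarrow> nat. (\<Sum>i\<in>UNIV. b i) \<le> n} \<subseteq> PiE UNIV (\<lambda>_. {..n})"
  proof
    fix b :: "'i \<Rightarrow> nat" assume "b \<in> {b. (\<Sum>i\<in>UNIV. b i) \<le> n}"
    then have "b i \<le> n" for i using member_le_sum[of i UNIV b] by simp
    then show "b \<in> PiE UNIV (\<lambda>_. {..n})" by (simp add: PiE_UNIV_domain Pi_def)
  qed
qed (simp add: finite_PiE)

lemma pairing_real_point: "pairing (complex_vec l, 1) x = complex_of_real (1 + x \<bullet> l)"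
  by (simp add: pairing_directional)

lemma tube_real_point: "l \<in> interior \<Gamma> \<Longrightarrow> (complex_vec l, 1) \<in> tube \<Gamma>"
  by (simp add: tube_def Re_vec_def complex_vec_def)

text \<open>At the real point the moment integrands are real functions, so the real quadrature
  result applies to the finitely many multi-indices of total order at most \<open>n\<close>.
  Choosing the atoms in \<open>space M\<close> puts them in the dual cone.\<close>

lemma matching_atoms:
  fixes lam :: "real^'n::finite"
  assumes M: "measure_on_dual \<Gamma> M" and lam: "lam \<in> interior \<Gamma>"
  shows "\<exists>A c. finite A \<and> A \<subseteq> dual_cone \<Gamma> \<and> (\<forall>x\<in>A. c x \<ge> 0) \<and>
    (\<forall>b :: 'n option \<Rightarrow> nat. (\<Sum>i\<in>UNIV. b i) \<le> n \<longrightarrow>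
       moment (point_measure A (\<lambda>x. ennreal (c x))) b (complex_vec lam, 1) = moment M b (complex_vec lam, 1))"
proof -
  let ?f = "\<lambda>b x. (\<Prod>i\<in>UNIV. weight i x ^ b i) / (1 + x \<bullet> lam) ^ Suc (\<Sum>i\<in>UNIV. b i)"
  have f: "complex_of_real (\<Prod>i\<in>UNIV. weight i x ^ b i) / pairing (complex_vec lam, 1) x ^ Suc (\<Sum>i\<in>UNIV. b i)
      = complex_of_real (?f b x)" for b :: "'n option \<Rightarrow> nat" and x
    by (simp only: pairing_real_point of_real_divide of_real_power)
  have int: "integrable M (?f b)" for b :: "'n option \<Rightarrow> nat"
    using integrable_moment[OF M tube_real_point[OF lam], of b] unfolding f complex_of_real_integrable_eq .
  have "\<exists>A c. finite A \<and> A \<subseteq> space M \<and> (\<forall>x\<in>A. c x \<ge> 0) \<and>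
      (\<forall>b\<in>{b :: 'n option \<Rightarrow> nat. (\<Sum>i\<in>UNIV. b i) \<le> n}. (\<integral>x. ?f b x \<partial>M) = (\<Sum>x\<in>A. c x * ?f b x))"
    by (rule tchakaloff[OF finite_bounded_multiindices int]) auto
  then obtain A c where A: "finite A" "A \<subseteq> space M" "\<forall>x\<in>A. c x \<ge> 0"
    "\<forall>b\<in>{b :: 'n option \<Rightarrow> nat. (\<Sum>i\<in>UNIV. b i) \<le> n}. (\<integral>x. ?f b x \<partial>M) = (\<Sum>x\<in>A. c x * ?f b x)"
    by (elim exE conjE)
  have "space M \<subseteq> dual_cone \<Gamma>" using M by (simp add: measure_on_dual_def)
  then have sub: "A \<subseteq> dual_cone \<Gamma>" using A(2) by blast
  have "moment (point_measure A (\<lambda>x. ennreal (c x))) b (complex_vec lam, 1) = moment M b (complex_vec lam, 1)"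
    if "(\<Sum>i\<in>UNIV. b i) \<le> n" for b :: "'n option \<Rightarrow> nat"
    unfolding moment_def f
    using A(1,3) A(4)[rule_format, of b] that
    by (simp add: lebesgue_integral_point_measure_finite del: power_Suc of_real_prod of_real_divide)
  then show ?thesis using A(1,3) sub by blast
qed

text \<open>Through this the finite sums are themselves transforms of admissible measures, so the
  derivative formula and the comparison of transforms apply to them and to the given transform
  alike.\<close>

lemma measure_on_dual_point_measure:
  assumes "finite A" "A \<subseteq> dual_cone \<Gamma>"
  shows "measure_on_dual \<Gamma> (point_measure A (\<lambda>x. ennreal (c x)))"
  using assms
  by (auto simp: measure_on_dual_def space_point_measure intro!: finite_measureI)
    (simp add: emeasure_point_measure_finite)

subsection \<open>Uniform convergence\<close>

definition hom_pairing :: "('n::finite) cpoint \<Rightarrow> real^'n option \<Rightarrow> complex" where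
  "hom_pairing p v = snd p * complex_of_real (v $ None) +
     (\<Sum>k\<in>UNIV. fst p $ k * complex_of_real (v $ Some k))"

definition space_part :: "real^('n::finite) option \<Rightarrow> real^'n" where
  "space_part v = (\<chi> k. v $ Some k)"

text \<open>A compact base of the cone of all \<open>(s, x)\<close> with \<open>s \<ge> 0\<close> and \<open>x\<close> in the dual cone.\<close>

definition dual_slice :: "(real^'n) set \<Rightarrow> real^'n \<Rightarrow> (real^('n::finite) option) set" where
  "dual_slice \<Gamma> l = {v. v $ None \<ge> 0 \<and> space_part v \<in> dual_cone \<Gamma> \<and> v $ None + space_part v \<bullet> l = 1}"

text \<open>This is the central projection of (1, x) to the compact slice. Its first coordinate is
  positive for \<open>x\<close> in the dual cone; the points of the slice with first coordinate 0
  are limits at infinity.\<close>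

definition slice_point :: "real^'n \<Rightarrow> real^'n \<Rightarrow> real^('n::finite) option" where
  "slice_point l x = (\<chi> i. weight i x / (1 + x \<bullet> l))"

lemma dual_cone_inner_nonneg: "x \<in> dual_cone \<Gamma> \<Longrightarrow> l \<in> interior \<Gamma> \<Longrightarrow> x \<bullet> l \<ge> 0"
  using interior_subset by (auto simp: dual_cone_def)

lemma compact_dual_slice:
  fixes \<Gamma> :: "(real^'n::finite) set"
  assumes "l \<in> interior \<Gamma>"
  shows "compact (dual_slice \<Gamma> l)"
proof -
  have cont: "continuous_on UNIV (\<lambda>v. space_part v :: real^'n)"
    unfolding space_part_def by (intro continuous_intros)
  have "dual_slice \<Gamma> l = {v. 0 \<le> v $ None} \<inter> (\<Inter>x\<in>\<Gamma>. {v. 0 \<le> space_part v \<bullet> x}) \<inter>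
      {v. v $ None + space_part v \<bullet> l = 1}"
    by (auto simp: dual_slice_def dual_cone_def)
  then have "closed (dual_slice \<Gamma> l)"
    by (auto intro!: closed_Int closed_INT closed_Collect_le closed_Collect_eq continuous_intros cont)
  moreover have "bounded (dual_slice \<Gamma> l)"
  proof -
    obtain r where r: "r > 0" "\<And>x. x \<in> dual_cone \<Gamma> \<Longrightarrow> x \<bullet> l \<ge> r * norm x"
      using dual_cone_inner_ge[OF assms] by blast
    \<comment> \<open>Both summands of the normalisation are nonnegative and add up to 1, so each is
      at most 1. This bounds the first coordinate by 1 and the norm of the space part by
      \<open>1 / r\<close>; the sum of the absolute coordinates then bounds the norm.\<close>
    have "norm v \<le> 1 + real CARD('n) * (1 / r)" if v: "v \<in> dual_slice \<Gamma> l" for v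
    proof -
      have *: "v $ None \<ge> 0" "r * norm (space_part v) \<le> space_part v \<bullet> l"
        "v $ None + space_part v \<bullet> l = 1"
        using v r by (auto simp: dual_slice_def)
      have "0 \<le> r * norm (space_part v)" using r by simp
      then have "\<bar>v $ None\<bar> \<le> 1" "r * norm (space_part v) \<le> 1"
        using * by linarith+
      moreover from this(2) have "norm (space_part v) \<le> 1 / r"
        using r(1) by (simp add: field_simps)
      moreover have "\<bar>v $ Some k\<bar> \<le> norm (space_part v)" for k
        using component_le_norm_cart[of "space_part v" k] by (simp add: space_part_def)
      ultimately have "(\<Sum>k\<in>UNIV. \<bar>v $ Some k\<bar>) \<le> (\<Sum>k\<in>(UNIV::'n set). 1 / r)"
        by (intro sum_mono) (meson order_trans)
      then show ?thesis
        using norm_le_l1_cart[of v] \<open>\<bar>v $ None\<bar> \<le> 1\<close> by (simp add: sum_option_UNIV)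
    qed
    then show ?thesis by (rule boundedI)
  qed
  ultimately show ?thesis by (simp add: compact_eq_bounded_closed)
qed

lemma Re_hom_pairing: "Re (hom_pairing p v) = Re (snd p) * v $ None + space_part v \<bullet> Re_vec (fst p)"
  by (simp add: hom_pairing_def space_part_def Re_vec_def inner_vec_def mult.commute)

text \<open>At a point at infinity the term with z0 vanishes. Positivity is then due to the space
  part, which is nonzero by the normalisation and pairs strictly positively with interior points of
  the cone.\<close>

lemma Re_hom_pairing_pos:
  assumes "p \<in> tube \<Gamma>" "l \<in> interior \<Gamma>" "v \<in> dual_slice \<Gamma> l"
  shows "Re (hom_pairing p v) > 0"
proof -
  have p: "Re_vec (fst p) \<in> interior \<Gamma>" "Re (snd p) > 0" using assms(1) by (auto simp: tube_def)
  have v: "v $ None \<ge> 0" "space_part v \<in> dual_cone \<Gamma>" "v $ None + space_part v \<bullet> l = 1"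
    using assms(3) by (auto simp: dual_slice_def)
  show ?thesis
  proof (cases "v $ None = 0")
    case True
    then have "space_part v \<noteq> 0" using v by auto
    moreover obtain r where "r > 0" "space_part v \<bullet> Re_vec (fst p) \<ge> r * norm (space_part v)"
      using dual_cone_inner_ge[OF p(1)] v(2) by metis
    ultimately have "space_part v \<bullet> Re_vec (fst p) > 0"
      by (smt (verit) mult_pos_pos zero_less_norm_iff)
    then show ?thesis using True by (simp add: Re_hom_pairing)
  next
    case False
    then have "Re (snd p) * v $ None > 0" using p v by simp
    then show ?thesis using dual_cone_inner_nonneg[OF v(2) p(1)] by (simp add: Re_hom_pairing)
  qed
qed

lemma slice_point_in_dual_slice:
  assumes "x \<in> dual_cone \<Gamma>" "l \<in> interior \<Gamma>"
  shows "slice_point l x \<in> dual_slice \<Gamma> l"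
proof -
  have pos: "1 + x \<bullet> l > 0" using dual_cone_inner_nonneg[OF assms] by simp
  have sp: "space_part (slice_point l x) = (1 / (1 + x \<bullet> l)) *\<^sub>R x"
    by (simp add: space_part_def slice_point_def weight_def vec_eq_iff)
  have "space_part (slice_point l x) \<in> dual_cone \<Gamma>"
    unfolding sp using assms(1) pos by (auto simp: dual_cone_def)
  moreover have "slice_point l x $ None = 1 / (1 + x \<bullet> l)"
    by (simp add: slice_point_def weight_def)
  ultimately show ?thesis using pos by (simp add: dual_slice_def sp add_divide_distrib[symmetric])
qed

lemma pairing_eq_hom_pairing:
  assumes "1 + x \<bullet> l \<noteq> 0"
  shows "pairing p x = complex_of_real (1 + x \<bullet> l) * hom_pairing p (slice_point l x)"
proof -
  have "complex_of_real (1 + x \<bullet> l) * (complex_of_real (slice_point l x $ i)) = complex_of_real (weight i x)" for i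
    unfolding of_real_mult[symmetric] using assms by (simp add: slice_point_def)
  then show ?thesis
    by (simp add: pairing_def hom_pairing_def distrib_left sum_distrib_left mult.left_commute weight_def)
qed

text \<open>The degree is tracked because it determines how many moments must agree. Generation by
  monomials and sums provides the induction needed to compare integrals.\<close>

inductive poly_degree_le :: "nat \<Rightarrow> (real^'i \<Rightarrow> real) \<Rightarrow> bool" where
  monomial: "(\<Sum>i\<in>UNIV. b i) \<le> N \<Longrightarrow> poly_degree_le N (\<lambda>v. c * (\<Prod>i\<in>UNIV. (v $ i) ^ b i))"
| add: "poly_degree_le N f \<Longrightarrow> poly_degree_le N g \<Longrightarrow> poly_degree_le N (\<lambda>v. f v + g v)"

lemma poly_degree_le_mono: "poly_degree_le N f \<Longrightarrow> N \<le> N' \<Longrightarrow> poly_degree_le N' f"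
  by (induction rule: poly_degree_le.induct) (auto intro: poly_degree_le.intros)

lemma poly_degree_le_const: "poly_degree_le N (\<lambda>v. c)"
  using poly_degree_le.monomial[of "\<lambda>_. 0" N c] by simp

lemma poly_degree_le_component: "poly_degree_le (Suc 0) (\<lambda>v. c * v $ j)"
proof -
  have "(\<Prod>i\<in>UNIV. (v $ i) ^ (if i = j then 1 else 0)) = v $ j" for v :: "real^'a"
    by (simp add: if_distrib[of "\<lambda>n. _ ^ n"] cong: if_cong)
  then show ?thesis using poly_degree_le.monomial[of "\<lambda>i. if i = j then 1 else 0" "Suc 0" c] by simp
qed

lemma poly_degree_le_sum:
  "finite S \<Longrightarrow> (\<And>k. k \<in> S \<Longrightarrow> poly_degree_le N (f k)) \<Longrightarrow> poly_degree_le N (\<lambda>v. \<Sum>k\<in>S. f k v)"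
  by (induction S rule: finite_induct) (auto intro: poly_degree_le_const poly_degree_le.add)

lemma poly_degree_le_mult:
  assumes "poly_degree_le N f" "poly_degree_le N' g"
  shows "poly_degree_le (N + N') (\<lambda>v. f v * g v)"
  using assms
proof (induction rule: poly_degree_le.induct)
  case (monomial b N c)
  from monomial(2) show ?case
  proof (induction rule: poly_degree_le.induct)
    case (monomial b' N' c')
    have "(\<lambda>v. c * (\<Prod>i\<in>UNIV. (v $ i) ^ b i) * (c' * (\<Prod>i\<in>UNIV. (v $ i) ^ b' i)))
        = (\<lambda>v. (c * c') * (\<Prod>i\<in>UNIV. (v $ i) ^ (b i + b' i)))"
      by (simp add: power_add prod.distrib mult_ac)
    then show ?case
      using poly_degree_le.monomial[of "\<lambda>i. b i + b' i" "N + N'" "c * c'"] monomial \<open>sum b UNIV \<le> N\<close>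
      by (simp add: sum.distrib)
  next
    case (add N' f g)
    then show ?case unfolding distrib_left by (intro poly_degree_le.add)
  qed
next
  case (add N f h)
  then show ?case unfolding distrib_right by (intro poly_degree_le.add)
qed

text \<open>One \<open>N\<close> serves all \<open>p\<close>: it is read off from how
  \<open>G\<close> is built, and \<open>p\<close> enters only through the coefficients of the
  polynomial in \<open>v\<close>. In the linear case \<open>f (p, 0)\<close> is the constant
  term.\<close>

lemma real_polynomial_function_degree:
  fixes G :: "'a::real_normed_vector \<times> (real^'i) \<Rightarrow> real"
  assumes "real_polynomial_function G"
  shows "\<exists>N. \<forall>p. poly_degree_le N (\<lambda>v. G (p, v))"
  using assms
proof (induction rule: real_polynomial_function.induct)
  case (linear f)
  interpret bounded_linear f by fact
  have eq: "f (p, v) = f (p, 0) + (\<Sum>i\<in>UNIV. f (0, axis i 1) * v $ i)" for p v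
  proof -
    have expand: "(0, v) = (\<Sum>i\<in>UNIV. (v $ i) *\<^sub>R (0 :: 'a, axis i (1::real)))"
      using basis_expansion[of v]
      by (simp add: prod_eq_iff fst_sum snd_sum scalar_mult_eq_scaleR)
    have "f (0, v) = (\<Sum>i\<in>UNIV. f ((v $ i) *\<^sub>R (0, axis i 1)))"
      unfolding expand by (rule sum)
    also have "\<dots> = (\<Sum>i\<in>UNIV. v $ i * f (0, axis i 1))"
      by (simp only: scaleR real_scaleR_def)
    finally have "f (0, v) = (\<Sum>i\<in>UNIV. v $ i * f (0, axis i 1))" .
    moreover have "f (p, v) = f (p, 0) + f (0, v)" by (simp add: add[symmetric])
    ultimately show ?thesis by (simp add: mult.commute)
  qed
  have "poly_degree_le (Suc 0) (\<lambda>v. f (p, 0) + (\<Sum>i\<in>UNIV. f (0, axis i 1) * v $ i))" for p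
    by (intro poly_degree_le.add[OF poly_degree_le_const poly_degree_le_sum[OF finite]])
      (rule poly_degree_le_component)
  then have "\<forall>p. poly_degree_le (Suc 0) (\<lambda>v. f (p, v))" unfolding eq[symmetric] ..
  then show ?case by blast
next
  case (const c)
  show ?case using poly_degree_le_const by blast
next
  case (add f g)
  then obtain N N' where "\<forall>p. poly_degree_le N (\<lambda>v. f (p, v))" "\<forall>p. poly_degree_le N' (\<lambda>v. g (p, v))"
    by blast
  then have "\<forall>p. poly_degree_le (max N N') (\<lambda>v. f (p, v) + g (p, v))"
    by (intro allI poly_degree_le.add) (erule allE, erule poly_degree_le_mono, simp)+
  then show ?case by blast
next
  case (mult f g)
  then obtain N N' where "\<forall>p. poly_degree_le N (\<lambda>v. f (p, v))" "\<forall>p. poly_degree_le N' (\<lambda>v. g (p, v))"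
    by blast
  then have "\<forall>p. poly_degree_le (N + N') (\<lambda>v. f (p, v) * g (p, v))"
    by (intro allI poly_degree_le_mult) (erule allE, assumption)+
  then show ?case by blast
qed

section \<open>Comparison of transforms of measures with equal moments\<close>

definition same_moments :: "nat \<Rightarrow> real^'n \<Rightarrow> (real^'n::finite) measure \<Rightarrow> (real^'n) measure \<Rightarrow> bool" where
  "same_moments N l M M' \<longleftrightarrow> (\<forall>b :: 'n option \<Rightarrow> nat. (\<Sum>i\<in>UNIV. b i) \<le> N \<longrightarrow>
     moment M b (complex_vec l, 1) = moment M' b (complex_vec l, 1))"

text \<open>A monomial of exact degree k at the slice point has denominator D^k, and the density
  supplies one more factor 1 / D. The result is precisely the integrand of a moment with total order
  k at the real point.\<close>

lemma same_moments_poly: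
  assumes "poly_degree_le N q" and M: "measure_on_dual \<Gamma> M" "measure_on_dual \<Gamma> M'"
    and l: "l \<in> interior \<Gamma>" and "same_moments N l M M'"
  shows "integrable M (\<lambda>x. q (slice_point l x) / (1 + x \<bullet> l)) \<and>
    integrable M' (\<lambda>x. q (slice_point l x) / (1 + x \<bullet> l)) \<and>
    (\<integral>x. q (slice_point l x) / (1 + x \<bullet> l) \<partial>M) = (\<integral>x. q (slice_point l x) / (1 + x \<bullet> l) \<partial>M')"
  using assms(1,5)
proof (induction rule: poly_degree_le.induct)
  case (monomial b N c)
  let ?f = "\<lambda>x. (\<Prod>i\<in>UNIV. weight i x ^ b i) / (1 + x \<bullet> l) ^ Suc (\<Sum>i\<in>UNIV. b i)"
  have eq: "c * (\<Prod>i\<in>UNIV. (slice_point l x $ i) ^ b i) / (1 + x \<bullet> l) = c * ?f x" for x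
    by (simp add: slice_point_def power_divide prod_dividef power_sum)
  have f: "complex_of_real (\<Prod>i\<in>UNIV. weight i x ^ b i) /
      pairing (complex_vec l, 1) x ^ Suc (\<Sum>i\<in>UNIV. b i) = complex_of_real (?f x)" for x
    by (simp only: pairing_real_point of_real_divide of_real_power)
  have int: "integrable M ?f" "integrable M' ?f"
    using integrable_moment[OF M(1) tube_real_point[OF l], of b]
      integrable_moment[OF M(2) tube_real_point[OF l], of b]
    unfolding f complex_of_real_integrable_eq .
  have "moment M b (complex_vec l, 1) = moment M' b (complex_vec l, 1)"
    using monomial by (simp add: same_moments_def)
  then have "(\<integral>x. ?f x \<partial>M) = (\<integral>x. ?f x \<partial>M')"
    unfolding moment_def f integral_complex_of_real of_real_eq_iff .
  then show ?case
    unfolding eq by (intro conjI integrable_mult_right int) (simp only: integral_mult_right_zero)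
next
  case (add N f g)
  then show ?case by (simp add: add_divide_distrib)
qed

text \<open>By homogeneity the kernel is the density 1 / D times a function on the slice, so a
  uniform error on the slice is multiplied by the integral of the density. The real polynomials
  \<open>g\<close> and \<open>h\<close> approximate real and imaginary part separately, whence the
  factor 2.\<close>

lemma stieltjes_fantappie_approx:
  assumes M: "measure_on_dual \<Gamma> M" and l: "l \<in> interior \<Gamma>" and p: "p \<in> tube \<Gamma>"
    and int: "integrable M (\<lambda>x. g (slice_point l x) / (1 + x \<bullet> l))"
      "integrable M (\<lambda>x. h (slice_point l x) / (1 + x \<bullet> l))"
    and g: "\<And>v. v \<in> dual_slice \<Gamma> l \<Longrightarrow> \<bar>Re (1 / hom_pairing p v) - g v\<bar> \<le> e"
    and h: "\<And>v. v \<in> dual_slice \<Gamma> l \<Longrightarrow> \<bar>Im (1 / hom_pairing p v) - h v\<bar> \<le> e"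
  shows "cmod (stieltjes_fantappie M p - Complex (\<integral>x. g (slice_point l x) / (1 + x \<bullet> l) \<partial>M)
      (\<integral>x. h (slice_point l x) / (1 + x \<bullet> l) \<partial>M)) \<le> 2 * e * (\<integral>x. 1 / (1 + x \<bullet> l) \<partial>M)"
proof -
  have intP: "integrable M (\<lambda>x. 1 / pairing p x)"
    using integrable_moment[OF M p, of "\<lambda>_. 0"] by simp
  have "integrable M (\<lambda>x. complex_of_real (1 / (1 + x \<bullet> l)))"
    using integrable_moment[OF M tube_real_point[OF l], of "\<lambda>_. 0"] by (simp add: pairing_real_point)
  then have int0: "integrable M (\<lambda>x. 1 / (1 + x \<bullet> l))" unfolding complex_of_real_integrable_eq .
  let ?G = "\<lambda>x. complex_of_real (g (slice_point l x) / (1 + x \<bullet> l)) +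
      \<i> * complex_of_real (h (slice_point l x) / (1 + x \<bullet> l))"
  have intG: "integrable M ?G"
    using int by (intro Bochner_Integration.integrable_add integrable_mult_right integrable_of_real)
  have G: "Complex (\<integral>x. g (slice_point l x) / (1 + x \<bullet> l) \<partial>M)
      (\<integral>x. h (slice_point l x) / (1 + x \<bullet> l) \<partial>M) = (\<integral>x. ?G x \<partial>M)"
    using int by (subst Bochner_Integration.integral_add)
      (auto simp del: of_real_divide simp: Complex_eq)
  have bound: "cmod (1 / pairing p x - ?G x) \<le> 2 * e * (1 / (1 + x \<bullet> l))" if x: "x \<in> space M" for x
  proof -
    have xd: "x \<in> dual_cone \<Gamma>" using x M by (auto simp: measure_on_dual_def)
    have pos: "1 + x \<bullet> l > 0" using dual_cone_inner_nonneg[OF xd l] by simp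
    define v where "v = slice_point l x"
    have v: "v \<in> dual_slice \<Gamma> l" unfolding v_def by (rule slice_point_in_dual_slice[OF xd l])
    have "1 / pairing p x - ?G x = complex_of_real (1 / (1 + x \<bullet> l)) *
        (1 / hom_pairing p v - Complex (g v) (h v))"
      using pairing_eq_hom_pairing[of x l p] pos
      by (simp add: v_def[symmetric] Complex_eq right_diff_distrib distrib_left)
    also have "cmod \<dots> = (1 / (1 + x \<bullet> l)) * cmod (1 / hom_pairing p v - Complex (g v) (h v))"
      using pos by (simp add: norm_mult norm_divide del: of_real_add)
    also have "\<dots> \<le> (1 / (1 + x \<bullet> l)) * (2 * e)"
    proof (rule mult_left_mono)
      show "cmod (1 / hom_pairing p v - Complex (g v) (h v)) \<le> 2 * e"
        using cmod_le[of "1 / hom_pairing p v - Complex (g v) (h v)"] g[OF v] h[OF v] by simp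
    qed (use pos in simp)
    finally show ?thesis by simp
  qed
  have "cmod (\<integral>x. 1 / pairing p x - ?G x \<partial>M) \<le> (\<integral>x. cmod (1 / pairing p x - ?G x) \<partial>M)"
    by (rule integral_norm_bound)
  also have "\<dots> \<le> (\<integral>x. 2 * e * (1 / (1 + x \<bullet> l)) \<partial>M)"
    using bound intP intG int0
    by (intro integral_mono integrable_norm Bochner_Integration.integrable_diff integrable_mult_right) auto
  also have "\<dots> = 2 * e * (\<integral>x. 1 / (1 + x \<bullet> l) \<partial>M)" by (rule integral_mult_right_zero)
  also have "(\<integral>x. 1 / pairing p x - ?G x \<partial>M) = (\<integral>x. 1 / pairing p x \<partial>M) - (\<integral>x. ?G x \<partial>M)"
    by (rule Bochner_Integration.integral_diff[OF intP intG])
  finally show ?thesis unfolding G stieltjes_fantappie_eq .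
qed

text \<open>Approximating jointly on the product of \<open>K\<close> with the slice yields one
  degree \<open>N\<close> for all points of \<open>K\<close> and all pairs of measures. Integrals of
  the approximating polynomial agree, so two errors of size 2 e times the mass remain.\<close>

lemma same_moments_stieltjes_fantappie_close:
  fixes \<Gamma> :: "(real^'n::finite) set"
  assumes K: "compact K" "K \<subseteq> tube \<Gamma>" and l: "l \<in> interior \<Gamma>" and e: "e > 0"
  shows "\<exists>N. \<forall>M M' p. measure_on_dual \<Gamma> M \<longrightarrow> measure_on_dual \<Gamma> M' \<longrightarrow> same_moments N l M M' \<longrightarrow> p \<in> K \<longrightarrow>
    cmod (stieltjes_fantappie M p - stieltjes_fantappie M' p) \<le> 4 * e * (\<integral>x. 1 / (1 + x \<bullet> l) \<partial>M)"
proof -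
  let ?S = "K \<times> dual_slice \<Gamma> l"
  have S: "compact ?S" by (intro compact_Times K compact_dual_slice l)
  have ne: "hom_pairing (fst q) (snd q) \<noteq> 0" if "q \<in> ?S" for q
    using Re_hom_pairing_pos[OF _ l, of "fst q" "snd q"] that K(2) by fastforce
  have "continuous_on ?S (\<lambda>q. 1 / hom_pairing (fst q) (snd q))"
    using ne unfolding hom_pairing_def by (intro continuous_intros) auto
  note cont = continuous_on_Re[OF this] continuous_on_Im[OF this]
  obtain g where g: "real_polynomial_function g"
    "\<And>q. q \<in> ?S \<Longrightarrow> \<bar>Re (1 / hom_pairing (fst q) (snd q)) - g q\<bar> < e"
    using Stone_Weierstrass_real_polynomial_function[OF S cont(1) e] by blast
  obtain h where h: "real_polynomial_function h"
    "\<And>q. q \<in> ?S \<Longrightarrow> \<bar>Im (1 / hom_pairing (fst q) (snd q)) - h q\<bar> < e"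
    using Stone_Weierstrass_real_polynomial_function[OF S cont(2) e] by blast
  obtain N1 where N1: "\<And>p. poly_degree_le N1 (\<lambda>v. g (p, v))"
    using real_polynomial_function_degree[OF g(1)] by blast
  obtain N2 where N2: "\<And>p. poly_degree_le N2 (\<lambda>v. h (p, v))"
    using real_polynomial_function_degree[OF h(1)] by blast
  define N where "N = max N1 N2"
  show ?thesis
  proof (intro exI[of _ N] allI impI)
    fix M M' :: "(real^'n) measure" and p
    assume M: "measure_on_dual \<Gamma> M" "measure_on_dual \<Gamma> M'" and same: "same_moments N l M M'" and p: "p \<in> K"
    have pt: "p \<in> tube \<Gamma>" using p K by blast
    have "poly_degree_le N (\<lambda>v. g (p, v))" "poly_degree_le N (\<lambda>v. h (p, v))"
      using poly_degree_le_mono[OF N1] poly_degree_le_mono[OF N2] by (auto simp: N_def)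
    note g' = same_moments_poly[OF this(1) M l same] and h' = same_moments_poly[OF this(2) M l same]
    \<comment> \<open>The moment of order 0 is matched for every \<open>N\<close>, so both error
      bounds refer to the same mass.\<close>
    have m0: "(\<integral>x. 1 / (1 + x \<bullet> l) \<partial>M) = (\<integral>x. 1 / (1 + x \<bullet> l) \<partial>M')"
      using same_moments_poly[OF poly_degree_le_const[of N 1] M l same] by simp
    have bg: "\<bar>Re (1 / hom_pairing p v) - g (p, v)\<bar> \<le> e" and bh: "\<bar>Im (1 / hom_pairing p v) - h (p, v)\<bar> \<le> e"
      if "v \<in> dual_slice \<Gamma> l" for v
      using g(2)[of "(p, v)"] h(2)[of "(p, v)"] that p by auto
    let ?c = "Complex (\<integral>x. g (p, slice_point l x) / (1 + x \<bullet> l) \<partial>M)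
      (\<integral>x. h (p, slice_point l x) / (1 + x \<bullet> l) \<partial>M)"
    have 1: "cmod (stieltjes_fantappie M p - ?c) \<le> 2 * e * (\<integral>x. 1 / (1 + x \<bullet> l) \<partial>M)"
      by (rule stieltjes_fantappie_approx[OF M(1) l pt, where g = "\<lambda>v. g (p, v)" and h = "\<lambda>v. h (p, v)"])
        (use g' h' bg bh in auto)
    have c: "?c = Complex (\<integral>x. g (p, slice_point l x) / (1 + x \<bullet> l) \<partial>M')
      (\<integral>x. h (p, slice_point l x) / (1 + x \<bullet> l) \<partial>M')" using g' h' by simp
    have 2: "cmod (stieltjes_fantappie M' p - ?c) \<le> 2 * e * (\<integral>x. 1 / (1 + x \<bullet> l) \<partial>M)"
      unfolding c m0
      by (rule stieltjes_fantappie_approx[OF M(2) l pt, where g = "\<lambda>v. g (p, v)" and h = "\<lambda>v. h (p, v)"])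
        (use g' h' bg bh in auto)
    have "cmod (stieltjes_fantappie M p - stieltjes_fantappie M' p)
      \<le> cmod (stieltjes_fantappie M p - ?c) + cmod (stieltjes_fantappie M' p - ?c)"
      using norm_triangle_ineq4[of "stieltjes_fantappie M p - ?c" "stieltjes_fantappie M' p - ?c"] by simp
    then show "cmod (stieltjes_fantappie M p - stieltjes_fantappie M' p) \<le> 4 * e * (\<integral>x. 1 / (1 + x \<bullet> l) \<partial>M)"
      using 1 2 by linarith
  qed
qed

section \<open>Assembly of the approximating sequence\<close>

lemma measure_on_dual_restrict:
  assumes "finite_measure M" "sets M = sets (restrict_space borel (dual_cone \<Gamma>))"
  shows "measure_on_dual \<Gamma> M"
proof -
  have "space M = dual_cone \<Gamma>"
    using sets_eq_imp_space_eq[OF assms(2)] by (simp add: space_restrict_space)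
  moreover have "(\<lambda>x. x) \<in> M \<rightarrow>\<^sub>M borel"
    unfolding measurable_cong_sets[OF assms(2) refl] by (rule measurable_restrict_space1) simp
  ultimately show ?thesis using assms(1) by (simp add: measure_on_dual_def)
qed

lemma same_moments_taylor_coeff:
  fixes M :: "(real^'n::finite) measure"
  assumes "measure_on_dual \<Gamma> M" "measure_on_dual \<Gamma> M'" "l \<in> interior \<Gamma>" "same_moments N l M M'"
    and "(\<Sum>i\<in>UNIV. \<alpha> i) \<le> N"
  shows "taylor_coeff (stieltjes_fantappie M) (complex_vec l, 1) \<alpha>
    = taylor_coeff (stieltjes_fantappie M') (complex_vec l, 1) \<alpha>"
proof -
  obtain b K where b: "(\<Sum>k\<in>UNIV. b k) = (\<Sum>k\<in>UNIV. \<alpha> k)"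
    "\<forall>M. measure_on_dual \<Gamma> M \<longrightarrow>
       (\<forall>q\<in>tube \<Gamma>. multi_deriv \<alpha> (stieltjes_fantappie M) q = K * moment M b q)"
    using multi_deriv_stieltjes_fantappie[of \<alpha> \<Gamma>] by (elim exE conjE)
  then show ?thesis
    using assms tube_real_point[OF assms(3)] by (simp add: taylor_coeff_def same_moments_def)
qed

theorem theorem6p6:
  fixes \<Gamma> :: "(real^'n) set" and \<mu> :: "(real^'n) measure" and lam :: "real^'n"
  assumes "acute_solid_cone \<Gamma>"
    and "finite_measure \<mu>"
    and "sets \<mu> = sets (restrict_space borel (dual_cone \<Gamma>))"
    and "lam \<in> interior \<Gamma>"
  shows "\<exists>\<Phi> :: nat \<Rightarrow> 'n cpoint \<Rightarrow> complex.
    (\<forall>n. rational_on (\<Phi> n) (tube \<Gamma> \<union> directional_points \<Gamma>) \<and>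
         herglotz_nevanlinna_on (\<Phi> n) (tube \<Gamma>) \<and>
         directional_stieltjes_sum \<Gamma> (\<Phi> n) \<and>
         (\<forall>\<alpha> :: 'n option \<Rightarrow> nat. (\<Sum>i\<in>UNIV. \<alpha> i) \<le> n \<longrightarrow>
            taylor_coeff (\<Phi> n) (complex_vec lam, 1) \<alpha> =
            taylor_coeff (stieltjes_fantappie \<mu>) (complex_vec lam, 1) \<alpha>)) \<and>
    (\<forall>K. compact K \<and> K \<subseteq> tube \<Gamma> \<longrightarrow>
         uniform_limit K \<Phi> (stieltjes_fantappie \<mu>) sequentially)"
proof -
  note l = assms(4)
  have M: "measure_on_dual \<Gamma> \<mu>" by (rule measure_on_dual_restrict[OF assms(2,3)])
  have "\<forall>n. \<exists>A c. finite A \<and> A \<subseteq> dual_cone \<Gamma> \<and> (\<forall>x\<in>A. c x \<ge> 0) \<and>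
      same_moments n lam (point_measure A (\<lambda>x. ennreal (c x))) \<mu>"
    unfolding same_moments_def using matching_atoms[OF M l] by (intro allI)
  from choice[OF this] obtain A where "\<forall>n. \<exists>c. finite (A n) \<and> A n \<subseteq> dual_cone \<Gamma> \<and> (\<forall>x\<in>A n. c x \<ge> 0) \<and>
      same_moments n lam (point_measure (A n) (\<lambda>x. ennreal (c x))) \<mu>" ..
  from choice[OF this] obtain c where "\<forall>n. finite (A n) \<and> A n \<subseteq> dual_cone \<Gamma> \<and> (\<forall>x\<in>A n. c n x \<ge> 0) \<and>
      same_moments n lam (point_measure (A n) (\<lambda>x. ennreal (c n x))) \<mu>" ..
  then have A: "\<And>n. finite (A n)" "\<And>n. A n \<subseteq> dual_cone \<Gamma>" "\<And>n. \<forall>x\<in>A n. c n x \<ge> 0"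
    and same: "\<And>n. same_moments n lam (point_measure (A n) (\<lambda>x. ennreal (c n x))) \<mu>" by auto
  define \<nu> where "\<nu> n = point_measure (A n) (\<lambda>x. ennreal (c n x))" for n
  have \<nu>: "measure_on_dual \<Gamma> (\<nu> n)" for n
    unfolding \<nu>_def by (rule measure_on_dual_point_measure[OF A(1,2)])
  define \<Phi> where "\<Phi> n = stieltjes_fantappie (\<nu> n)" for n
  have \<Phi>: "\<Phi> n = (\<lambda>p. \<Sum>x\<in>A n. complex_of_real (c n x) / pairing p x)" for n
    using A(1,3)[of n]
    by (simp add: \<Phi>_def \<nu>_def fun_eq_iff stieltjes_fantappie_eq lebesgue_integral_point_measure_finite
        scaleR_conv_of_real)
  show ?thesis
  proof (intro exI[of _ \<Phi>] conjI allI impI)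
    fix n
    show "rational_on (\<Phi> n) (tube \<Gamma> \<union> directional_points \<Gamma>)"
      unfolding \<Phi> using A(2) by (intro rational_on_atomic A(1) pairing_nonzero) auto
    show "herglotz_nevanlinna_on (\<Phi> n) (tube \<Gamma>)" "directional_stieltjes_sum \<Gamma> (\<Phi> n)"
      unfolding \<Phi> using A by (auto intro!: herglotz_nevanlinna_on_atomic directional_stieltjes_sum_atomic)
    fix \<alpha> :: "'n option \<Rightarrow> nat" assume "(\<Sum>i\<in>UNIV. \<alpha> i) \<le> n"
    then show "taylor_coeff (\<Phi> n) (complex_vec lam, 1) \<alpha> =
        taylor_coeff (stieltjes_fantappie \<mu>) (complex_vec lam, 1) \<alpha>"
      unfolding \<Phi>_def using same_moments_taylor_coeff[OF \<nu> M l] same by (auto simp: \<nu>_def)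
  next
    fix K :: "'n cpoint set" assume K: "compact K \<and> K \<subseteq> tube \<Gamma>"
    show "uniform_limit K \<Phi> (stieltjes_fantappie \<mu>) sequentially"
    proof (rule uniform_limitI)
      fix e :: real assume e: "e > 0"
      define m where "m = (\<integral>x. 1 / (1 + x \<bullet> lam) \<partial>\<mu>)"
      have m: "m \<ge> 0"
        unfolding m_def using M dual_cone_inner_nonneg[OF _ l]
        by (intro Bochner_Integration.integral_nonneg) (auto simp: measure_on_dual_def)
      \<comment> \<open>The error is at most \<open>4 * e' * m\<close>, where \<open>m\<close>
        belongs to \<open>\<mu>\<close> and so does not depend on \<open>n\<close>. The summand 1 in
        the denominator covers \<open>m = 0\<close> and makes the final inequality strict.\<close>
      define e' where "e' = e / (4 * m + 1)"
      have e': "e' > 0" using e m by (simp add: e'_def)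
      obtain N where N: "\<forall>M M' p. measure_on_dual \<Gamma> M \<longrightarrow> measure_on_dual \<Gamma> M' \<longrightarrow>
          same_moments N lam M M' \<longrightarrow> p \<in> K \<longrightarrow>
          cmod (stieltjes_fantappie M p - stieltjes_fantappie M' p) \<le> 4 * e' * (\<integral>x. 1 / (1 + x \<bullet> lam) \<partial>M)"
        using same_moments_stieltjes_fantappie_close[OF _ _ l e'] K by blast
      have "4 * e' * m < e" using e m by (simp add: e'_def field_simps)
      have "dist (\<Phi> n p) (stieltjes_fantappie \<mu> p) < e" if "n \<ge> N" "p \<in> K" for n p
      proof -
        \<comment> \<open>The moments of \<open>\<nu> n\<close> agree with those of
          \<open>\<mu>\<close> up to order \<open>n\<close>, hence up to the fixed order
          \<open>N\<close> for all larger \<open>n\<close>.\<close>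
        have "same_moments N lam \<mu> (\<nu> n)" using same[of n] that(1) by (simp add: same_moments_def \<nu>_def)
        then have "cmod (stieltjes_fantappie \<mu> p - \<Phi> n p) \<le> 4 * e' * m"
          using N M \<nu> that(2) unfolding m_def \<Phi>_def by blast
        then show ?thesis using \<open>4 * e' * m < e\<close> by (simp add: dist_norm norm_minus_commute)
      qed
      then show "\<forall>\<^sub>F n in sequentially. \<forall>p\<in>K. dist (\<Phi> n p) (stieltjes_fantappie \<mu> p) < e"
        unfolding eventually_sequentially by blast
    qed
  qed
qed

end
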